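(* Let $\alpha>0$, $\delta>0$, let $s\in\{2,3,\dots\}$ and $k\in\mathbb{N}$, $k\ge1$, put $n=k(s+1)-1$, and let $X_{(1,n)}\le\dots\le X_{(n,n)}$ be the order statistics of $n$ independent observations on a random variable $X\in Par(\alpha,\delta)$. Define $$Q^*_{k,s}=\frac{\log\frac{X_{(ks,(s+1)k-1)}}{X_{(k,(s+1)k-1)}}}{\log(s)}.$$ (i) If $\rho$ is Beta distributed with parameters $k$ and $(s-1)k$, then for all $k\in\mathbb{N}$, $$Q^*_{k,s}\stackrel{d}{=}-\frac{\log(\rho)}{\alpha\log(s)}\stackrel{d}{=}\frac{E_{((s-1)k,ks-1)}}{\log(s)}\stackrel{d}{=}\frac{E^*_{((s-1)k,ks-1)}}{\alpha\log(s)},$$ where $E_{((s-1)k,ks-1)}$ (respectively $E^*_{((s-1)k,ks-1)}$) is the $(s-1)k$-th order statistic of a sample of $ks-1$ independent exponential random variables with parameter $\alpha$ (respectively $1$). The probability density function of $Q^*_{k,s}$ is $$f_{Q^*_{k,s}}(x)=\frac{\alpha\log(s)\,(ks-1)!}{[(s-1)k-1]!\,(k-1)!}\left(1-s^{-\alpha x}\right)^{(s-1)k-1}s^{-\alpha kx},\qquad x>0.$$ (ii) For all $k\in\mathbb{N}$, $\mathbb{E}\,Q^*_{k,s}=\frac{H_{ks-1}-H_{k-1}}{\alpha\log(s)}$ and $\mathbb{D}\,Q^*_{k,s}=\frac{H_{ks-1,2}-H_{k-1,2}}{\alpha^2[\log(s)]^2}$. (iii) For all $\varepsilon>0$ and $k\in\mathbb{N}$,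 $$P\left[\left|Q^*_{k,s}-\frac{1}{\alpha}\right|>\varepsilon\right]\le\frac{H_{ks-1,2}-H_{k-1,2}}{\alpha^2\varepsilon^2[\log(s)]^2}.$$ (iv) For fixed $s$, $\lim_{k\to\infty}\mathbb{E}\,Q^*_{k,s}=\frac{1}{\alpha}$ and $\lim_{k\to\infty}\mathbb{D}\,Q^*_{k,s}=0$. (v) For fixed $s$, $Q^*_{k,s}$ is a weakly consistent estimator of $1/\alpha$: for all $\varepsilon>0$, $\lim_{k\to\infty}P\left[\left|Q^*_{k,s}-\frac{1}{\alpha}\right|>\varepsilon\right]=0$.
   Context: $X\in Par(\alpha,\delta)$ means that $X$ has c.d.f. $F_X(x)=0$ for $x\le\delta$ and $F_X(x)=1-(\delta/x)^{\alpha}$ for $x>\delta$. The exponential distribution with parameter $\lambda>0$ has c.d.f. $1-e^{-\lambda x}$ for $x>0$ and $0$ for $x\le 0$. Order statistics are increasing: the $m$-th order statistic is the $m$-th smallest value in the sample. $\stackrel{d}{=}$ is equality in distribution, $\mathbb{E}$ is expectation, $\mathbb{D}$ is variance, $\log$ is the natural logarithm. $H_{n,m}=\sum_{r=1}^{n} r^{-m}$ is the generalized harmonic number of power $m$, $H_n=H_{n,1}$, with $H_{0}=H_{0,2}=0$. *)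

theory Defs
  imports "HOL-Probability.Probability"
begin

definition pareto_cdf :: "real \<Rightarrow> real \<Rightarrow> real \<Rightarrow> real" where
  "pareto_cdf \<alpha> \<delta> x = (if x \<le> \<delta> then 0 else 1 - (\<delta> / x) powr \<alpha>)"

definition exponential_cdf :: "real \<Rightarrow> real \<Rightarrow> real" where
  "exponential_cdf l x = (if x \<le> 0 then 0 else 1 - exp (- l * x))"

definition beta_density :: "real \<Rightarrow> real \<Rightarrow> real \<Rightarrow> real" where
  "beta_density a b x =
     (if 0 < x \<and> x < 1 then x powr (a - 1) * (1 - x) powr (b - 1) / Beta a b else 0)"

text \<open>The observations of a sample of size \<open>n\<close> are indexed by \<open>0, \<dots>, n - 1\<close>;
  measurability is part of \<open>indep_vars\<close>.\<close>

definition iid_sample ::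
  "'a measure \<Rightarrow> nat \<Rightarrow> (real \<Rightarrow> real) \<Rightarrow> (nat \<Rightarrow> 'a \<Rightarrow> real) \<Rightarrow> bool" where
  "iid_sample M n F X \<longleftrightarrow>
     prob_space M \<and>
     prob_space.indep_vars M (\<lambda>_. borel) X {..<n} \<and>
     (\<forall>i<n. cdf (distr M borel (X i)) = F)"

text \<open>The rank \<open>m\<close> of an order statistic counts from 1, and is meant for \<open>1 \<le> m \<le> n\<close>;
  positions in a list count from 0.\<close>

definition order_stat :: "nat \<Rightarrow> nat \<Rightarrow> (nat \<Rightarrow> 'a \<Rightarrow> real) \<Rightarrow> 'a \<Rightarrow> real" where
  "order_stat m n X \<omega> = sort (map (\<lambda>i. X i \<omega>) [0..<n]) ! (m - 1)"

definition Qstar :: "nat \<Rightarrow> nat \<Rightarrow> (nat \<Rightarrow> 'a \<Rightarrow> real) \<Rightarrow> 'a \<Rightarrow> real" where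
  "Qstar k s X \<omega> =
     ln (order_stat (k * s) ((s + 1) * k - 1) X \<omega> / order_stat k ((s + 1) * k - 1) X \<omega>)
       / ln (real s)"

definition Qstar_density :: "real \<Rightarrow> nat \<Rightarrow> nat \<Rightarrow> real \<Rightarrow> real" where
  "Qstar_density \<alpha> k s x =
     (if x > 0 then
        \<alpha> * ln (real s) * fact (k * s - 1) / (fact ((s - 1) * k - 1) * fact (k - 1))
          * (1 - real s powr (- \<alpha> * x)) ^ ((s - 1) * k - 1)
          * real s powr (- \<alpha> * real k * x)
      else 0)"

definition eq_in_distr ::
  "'a measure \<Rightarrow> ('a \<Rightarrow> real) \<Rightarrow> 'b measure \<Rightarrow> ('b \<Rightarrow> real) \<Rightarrow> bool" where
  "eq_in_distr M X N Y \<longleftrightarrow>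
     X \<in> borel_measurable M \<and> Y \<in> borel_measurable N \<and> distr M borel X = distr N borel Y"

definition gen_harm :: "nat \<Rightarrow> nat \<Rightarrow> real" where
  "gen_harm n m = (\<Sum>r=1..n. 1 / real r ^ m)"

end

theory Submission
  imports Defs
begin

text \<open>
  For a Pareto observation \<open>X\<close>, the variable \<open>\<alpha> log (X / \<delta>)\<close> is standard exponential, so
  \<open>W = \<alpha> log(s) Q\<close> is the difference of the order statistics of ranks \<open>ks\<close> and \<open>k\<close> of
  \<open>k(s+1) - 1\<close> exponentials. By memorylessness, deleting the least observation and shifting the others
  yields a smaller exponential sample; after \<open>k\<close> deletions \<open>W\<close> has become the order statistic of rank
  \<open>(s-1)k\<close> among \<open>ks - 1\<close> exponentials, whose distribution function is a binomial tail. The moments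
  follow by integrating the derivative of the density.

  The tail bound is centred at \<open>1/\<alpha>\<close> and not at the mean, so Chebyshev's inequality alone falls
  short by the squared bias. The density decreases to the right of \<open>log s\<close>, where Gauss' inequality
  saves a factor \<open>4/9\<close>; to the left, \<open>(W - log s)\<^sup>2\<close> is dominated by \<open>(s exp(-W) - 1)\<^sup>2\<close>, whose
  expectation \<open>(s-1)/(sk+1)\<close> is below the variance by more than the squared bias.
\<close>

text \<open>The law of W is a beta law in disguise: exp(-W) is Beta distributed with parameters k
  and (s-1)k, and the binomial tail is its incomplete beta integral. Hence one function,
  \<open>spacing_cdf\<close>, serves all representations in (i), and powers of exp(-W) have rational
  moments. Since exp(-W) has mean exactly 1/s, the variable s exp(-W) is centred at 1, the image of
  W = log s. Its second moment about that point is a pure variance without a bias term, which is the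
  origin of (s-1)/(sk+1). The squared bias of W and the slack that must absorb it are both of order
  1/k^2, so constants matter. Let D be the variance of s exp(-W), V that of W, and b the bias of W.
  Weights 4/9 and 5/9 on the two comparison functions reduce the claim to D + 4/5 b^2 \<le> V. With
  A = 1/k - 1/(sk), the estimates are D \<le> A, b \<le> 2/3 A and A + A^2/2 \<le> V, and 4/5 * 4/9
  = 16/45 is less than 1/2.\<close>

section \<open>Binomial tails and the density of a spacing\<close>

text \<open>Strictly fewer than \<open>m\<close> successes: if \<open>u\<close> is the chance that
  an observation is at most x, this is the chance that the order statistic of rank \<open>m\<close>
  exceeds x.\<close>

definition binom_lower :: "nat \<Rightarrow> nat \<Rightarrow> real \<Rightarrow> real" where
  "binom_lower n m u = (\<Sum>r<m. real (n choose r) * u ^ r * (1 - u) ^ (n - r))"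

lemma binom_lower_0 [simp]: "binom_lower n 0 u = 0"
  by (simp add: binom_lower_def)

lemma binom_lower_at_0: "m \<ge> 1 \<Longrightarrow> binom_lower n m 0 = 1"
  unfolding binom_lower_def
  by (subst sum.remove[of _ 0]) auto

lemma binom_lower_at_1: "m \<le> n \<Longrightarrow> binom_lower n m 1 = 0"
  by (auto simp: binom_lower_def intro!: sum.neutral)

lemma binom_lower_no_trials: "m \<ge> 1 \<Longrightarrow> binom_lower 0 m u = 1"
  unfolding binom_lower_def
  by (subst sum.remove[of _ 0]) (auto intro!: sum.neutral simp: binomial_eq_0)

lemma binom_lower_nonneg: "0 \<le> u \<Longrightarrow> u \<le> 1 \<Longrightarrow> 0 \<le> binom_lower n m u"
  by (auto simp: binom_lower_def intro!: sum_nonneg)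

text \<open>Conditioning on a single trial: a failure leaves the bound on the successes, a success
  lowers it by one. The induction adds one summand at a time, where Pascal's rule applies.\<close>

lemma binom_lower_Suc_Suc:
  "binom_lower (Suc n) (Suc m) u = (1 - u) * binom_lower n (Suc m) u + u * binom_lower n m u"
proof (induction m)
  case 0
  show ?case by (simp add: binom_lower_def)
next
  case (Suc m)
  have step: "binom_lower k (Suc j) u = binom_lower k j u + real (k choose j) * u ^ j * (1 - u) ^ (k - j)" for k j
    by (simp add: binom_lower_def)
  \<comment> \<open>Truncated subtraction: the power splits only for \<open>Suc m \<le> n\<close>,
    and otherwise the coefficient vanishes.\<close>
  have *: "real (n choose Suc m) * (1 - u) ^ (n - m) = real (n choose Suc m) * ((1 - u) * (1 - u) ^ (n - Suc m))"
  proof (cases "Suc m \<le> n")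
    case True
    then have "n - m = Suc (n - Suc m)" by simp
    then show ?thesis by simp
  qed (simp add: binomial_eq_0)
  show ?case
    unfolding step[of _ "Suc m"] Suc.IH using arg_cong[OF *, of "\<lambda>x. u * (u ^ m * x)"]
    by (simp add: step algebra_simps)
qed

text \<open>The derivative of the sum telescopes. In the induction step the positive part of the new
  summand's derivative cancels what the hypothesis left (\<open>c1\<close>), and its negative part
  is the new value (\<open>c2\<close>).\<close>

lemma binom_lower_deriv:
  "(binom_lower (Suc n) (Suc m) has_real_derivative
      - (real (Suc n) * real (n choose m) * u ^ m * (1 - u) ^ (n - m))) (at u)"
proof (induction m)
  case 0
  have "binom_lower (Suc n) (Suc 0) = (\<lambda>u. (1 - u) ^ Suc n)"
    by (intro ext) (simp add: binom_lower_def)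
  moreover have "((\<lambda>u. (1 - u) ^ Suc n) has_real_derivative real (Suc n) * (1 - u) ^ n * - 1) (at u)"
    by (rule derivative_eq_intros refl | simp)+
  ultimately show ?case by simp
next
  case (Suc m)
  have eq: "binom_lower (Suc n) (Suc (Suc m)) = (\<lambda>u. binom_lower (Suc n) (Suc m) u
      + real (Suc n choose Suc m) * u ^ Suc m * (1 - u) ^ (n - m))"
    by (simp add: binom_lower_def fun_eq_iff)
  have c1: "real (Suc n choose Suc m) * real (Suc m) = real (Suc n) * real (n choose m)"
    using Suc_times_binomial_eq[of n m] by (metis mult.commute of_nat_mult)
  have c2: "real (Suc n choose Suc m) * real (n - m) = real (Suc n) * real (n choose Suc m)"
  proof -
    have "(n choose m) * (n - m) = (n choose Suc m) * Suc m"
      by (metis binomial_absorb_comp binomial_absorption mult.commute choose_rising_sum diff_Suc_Suc)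
    then have "real (n choose m) * real (n - m) = real (n choose Suc m) * real (Suc m)"
      by (metis of_nat_mult)
    then have "real (Suc m) * (real (Suc n choose Suc m) * real (n - m)) = real (Suc m) * (real (Suc n) * real (n choose Suc m))"
      using c1 by (metis mult.assoc mult.commute)
    then show ?thesis by simp
  qed
  have "(binom_lower (Suc n) (Suc (Suc m)) has_real_derivative
     - (real (Suc n) * real (n choose m) * u ^ m * (1 - u) ^ (n - m))
     + (real (Suc n choose Suc m) * (real (Suc m) * u ^ m) * (1 - u) ^ (n - m)
        - real (Suc n choose Suc m) * u ^ Suc m * (real (n - m) * (1 - u) ^ (n - m - 1)))) (at u)"
    unfolding eq
    by (rule DERIV_add[OF Suc.IH]) (auto intro!: derivative_eq_intros simp del: binomial_Suc_Suc of_nat_Suc power_Suc simp: algebra_simps)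
  also have "- (real (Suc n) * real (n choose m) * u ^ m * (1 - u) ^ (n - m))
     + (real (Suc n choose Suc m) * (real (Suc m) * u ^ m) * (1 - u) ^ (n - m)
        - real (Suc n choose Suc m) * u ^ Suc m * (real (n - m) * (1 - u) ^ (n - m - 1)))
     = - (real (Suc n choose Suc m) * real (n - m)) * u ^ Suc m * (1 - u) ^ (n - m - 1)
       + (real (Suc n choose Suc m) * real (Suc m) - real (Suc n) * real (n choose m)) * u ^ m * (1 - u) ^ (n - m)"
    by (simp add: algebra_simps del: binomial_Suc_Suc of_nat_Suc power_Suc)
  also have "\<dots> = - (real (Suc n) * real (n choose Suc m) * u ^ Suc m * (1 - u) ^ (n - Suc m))"
    unfolding c1 c2 by simp
  finally show ?case .
qed

text \<open>For positive arguments this is the reciprocal of the beta function at (a, k).\<close>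

definition spacing_const :: "nat \<Rightarrow> nat \<Rightarrow> real" where
  "spacing_const a k = fact (a + k - 1) / (fact (a - 1) * fact (k - 1))"

text \<open>The density of the difference of two order statistics of a standard exponential sample, where
  \<open>a\<close> is the difference of the ranks and \<open>k - 1\<close> observations exceed the larger one.\<close>

definition spacing_density :: "nat \<Rightarrow> nat \<Rightarrow> real \<Rightarrow> real" where
  "spacing_density a k x =
     (if x > 0 then spacing_const a k * (1 - exp (- x)) ^ (a - 1) * exp (- x) ^ k else 0)"

lemma spacing_const_pos: "spacing_const a k > 0"
  by (simp add: spacing_const_def)

lemma spacing_density_nonneg: "spacing_density a k x \<ge> 0"
  using spacing_const_pos[of a k] by (simp add: spacing_density_def)

lemma borel_measurable_spacing_density [measurable]: "spacing_density a k \<in> borel_measurable borel"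
  unfolding spacing_density_def by measurable

lemma binom_lower_deriv_spacing:
  assumes "a \<ge> 1" "k \<ge> 1"
  shows "(binom_lower (a + k - 1) a has_real_derivative
      - (spacing_const a k * u ^ (a - 1) * (1 - u) ^ (k - 1))) (at u)"
proof -
  obtain m j where m: "a = Suc m" "k = Suc j" using assms by (metis Suc_le_D One_nat_def)
  have "real (Suc (m + j)) * real (m + j choose m) = spacing_const a k"
    by (simp add: spacing_const_def m binomial_fact)
  then show ?thesis
    using binom_lower_deriv[of "m + j" m u] by (simp add: m)
qed

text \<open>The argument of \<open>binom_lower\<close> is the standard exponential distribution
  function, so this is the law of the order statistic of rank \<open>a\<close> among
  \<open>a + k - 1\<close> standard exponentials. All laws in (i) are identified through it.\<close>

definition spacing_cdf :: "nat \<Rightarrow> nat \<Rightarrow> real \<Rightarrow> real" where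
  "spacing_cdf a k x = 1 - binom_lower (a + k - 1) a (max 0 (1 - exp (- x)))"

text \<open>With u = 1 - exp(-cx) the integrand is the derivative of \<open>- binom_lower\<close>,
  which runs from -1 at x = 0 to 0 at infinity. The scale \<open>c\<close> is 1 for W and \<alpha>
  log(s) for the estimator.\<close>

lemma nn_integral_spacing_density:
  assumes "a \<ge> 1" "k \<ge> 1" "c > 0"
  shows "(\<integral>\<^sup>+x. ennreal (c * spacing_density a k (c * x)) * indicator {..z} x \<partial>lborel)
      = ennreal (spacing_cdf a k (c * z))" (is ?part)
    and "(\<integral>\<^sup>+x. ennreal (c * spacing_density a k (c * x)) \<partial>lborel) = 1" (is ?total)
proof -
  define f where "f x = c * (spacing_const a k * (1 - exp (- (c * x))) ^ (a - 1) * exp (- (c * x)) ^ k)" for x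
  define F where "F x = - binom_lower (a + k - 1) a (1 - exp (- (c * x)))" for x
  have [measurable]: "f \<in> borel_measurable borel" unfolding f_def by measurable
  have f_nonneg: "f x \<ge> 0" if "x \<ge> 0" for x
    using that assms spacing_const_pos[of a k] by (simp add: f_def)
  have F: "(F has_real_derivative f x) (at x)" for x
  proof -
    let ?u = "\<lambda>x. 1 - exp (- (c * x))"
    have "(?u has_real_derivative c * exp (- (c * x))) (at x)"
      by (auto intro!: derivative_eq_intros)
    from DERIV_chain2[OF binom_lower_deriv_spacing[OF assms(1,2)] this]
    have "(F has_real_derivative
      - (- (spacing_const a k * ?u x ^ (a - 1) * (1 - ?u x) ^ (k - 1)) * (c * exp (- (c * x))))) (at x)"
      unfolding F_def by (rule DERIV_minus)
    moreover have "exp (- (c * x)) ^ k = exp (- (c * x)) * exp (- (c * x)) ^ (k - 1)"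
      using \<open>k \<ge> 1\<close> by (metis One_nat_def Suc_pred less_le_trans power_Suc zero_less_one)
    ultimately show ?thesis by (simp add: f_def mult_ac)
  qed
  have F0: "F 0 = -1"
    using assms by (simp add: F_def binom_lower_at_0)
  \<comment> \<open>The two sides can differ only at 0: for \<open>a = 1\<close> the formula
    \<open>f\<close> is positive there, while \<open>spacing_density\<close> is 0.\<close>
  have ae: "AE x in lborel. ennreal (c * spacing_density a k (c * x)) = ennreal (f x) * indicator {0..} x"
    using AE_lborel_singleton[of "0::real"]
    by eventually_elim
       (use assms in \<open>auto simp: spacing_density_def f_def zero_less_mult_iff split: split_indicator\<close>)
  show ?part
  proof (cases "z \<ge> 0")
    case True
    have "(\<integral>\<^sup>+x. ennreal (c * spacing_density a k (c * x)) * indicator {..z} x \<partial>lborel)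
        = (\<integral>\<^sup>+x. ennreal (f x) * indicator {0..z} x \<partial>lborel)"
      using ae by (intro nn_integral_cong_AE, eventually_elim) (auto split: split_indicator)
    also have "\<dots> = ennreal (F z - F 0)"
      using F f_nonneg True by (intro nn_integral_FTC_Icc) auto
    also have "F z - F 0 = spacing_cdf a k (c * z)"
      using True \<open>c > 0\<close> by (simp add: F0) (simp add: F_def spacing_cdf_def max_def)
    finally show ?thesis .
  next
    case False
    have "(\<integral>\<^sup>+x. ennreal (c * spacing_density a k (c * x)) * indicator {..z} x \<partial>lborel)
        = (\<integral>\<^sup>+x. 0 \<partial>(lborel :: real measure))"
      using False \<open>c > 0\<close>
      by (intro nn_integral_cong) (auto simp: spacing_density_def zero_less_mult_iff split: split_indicator)
    also have "\<dots> = ennreal (spacing_cdf a k (c * z))"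
      using mult_pos_neg[of c z] False assms by (simp add: spacing_cdf_def max_def binom_lower_at_0)
    finally show ?thesis .
  qed
  have "(F \<longlongrightarrow> - binom_lower (a + k - 1) a (1 - 0)) at_top"
    unfolding F_def
  proof (intro tendsto_minus isCont_tendsto_compose[where g = "binom_lower (a + k - 1) a"])
    show "isCont (binom_lower (a + k - 1) a) (1 - 0)"
      using binom_lower_deriv_spacing[OF assms(1,2)] by (rule DERIV_isCont)
    have "filterlim (\<lambda>x. - (c * x)) at_bot at_top"
      using \<open>c > 0\<close> by real_asymp
    then show "((\<lambda>x. 1 - exp (- (c * x))) \<longlongrightarrow> 1 - 0) at_top"
      by (intro tendsto_intros filterlim_compose[OF exp_at_bot])
  qed
  moreover have "a \<le> a + k - 1" using assms by simp
  ultimately have lim: "(F \<longlongrightarrow> 0) at_top"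
    by (simp add: binom_lower_at_1)
  have "(\<integral>\<^sup>+x. ennreal (c * spacing_density a k (c * x)) \<partial>lborel)
        = (\<integral>\<^sup>+x. ennreal (f x) * indicator {0..} x \<partial>lborel)"
    using ae by (intro nn_integral_cong_AE)
  also have "\<dots> = ennreal (0 - F 0)"
    using F f_nonneg lim by (intro nn_integral_FTC_atLeast) auto
  finally show ?total by (simp add: F0)
qed

text \<open>On [0, 1] the derivative of \<open>binom_lower\<close> is nonpositive, so it stays below
  its value 1 at 0. Nonnegativity allows an equation in \<open>ennreal\<close> to be read back in
  the reals.\<close>

lemma spacing_cdf_nonneg:
  assumes "a \<ge> 1" "k \<ge> 1"
  shows "0 \<le> spacing_cdf a k x"
proof (rule ccontr)
  define z where "z = max 0 (1 - exp (- x))"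
  assume "\<not> ?thesis"
  then have "binom_lower (a + k - 1) a z > binom_lower (a + k - 1) a 0"
    using binom_lower_at_0[OF assms(1), of "a + k - 1"] unfolding spacing_cdf_def z_def[symmetric] by linarith
  moreover have "0 \<le> z" "z \<le> 1" by (auto simp: z_def)
  moreover have "binom_lower (a + k - 1) a z \<le> binom_lower (a + k - 1) a 0"
  proof (rule DERIV_nonpos_imp_nonincreasing[OF \<open>0 \<le> z\<close>])
    fix u assume "0 \<le> u" "u \<le> z"
    then have "- (spacing_const a k * u ^ (a - 1) * (1 - u) ^ (k - 1)) \<le> 0"
      using spacing_const_pos[of a k] \<open>z \<le> 1\<close> by simp
    then show "\<exists>y. (binom_lower (a + k - 1) a has_real_derivative y) (at u) \<and> y \<le> 0"
      using binom_lower_deriv_spacing[OF assms, of u] by blast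
  qed
  ultimately show False by simp
qed

lemma (in prob_space) distributed_spacing:
  assumes "a \<ge> 1" "k \<ge> 1" "c > 0"
    and [measurable]: "Z \<in> borel_measurable M"
    and cdf: "\<And>x. prob {\<omega> \<in> space M. Z \<omega> \<le> x} = spacing_cdf a k (c * x)"
  shows "distributed M lborel Z (\<lambda>x. ennreal (c * spacing_density a k (c * x)))"
proof -
  define D where "D = density lborel (\<lambda>x. ennreal (c * spacing_density a k (c * x)))"
  have "prob_space D"
    by (rule prob_spaceI) (use nn_integral_spacing_density(2)[OF assms(1-3)] in \<open>simp add: D_def emeasure_density\<close>)
  then have D: "real_distribution D"
    unfolding real_distribution_def real_distribution_axioms_def by (simp add: D_def)
  have "cdf (distr M borel Z) x = cdf D x" for x
  proof -
    have "cdf (distr M borel Z) x = prob {\<omega> \<in> space M. Z \<omega> \<le> x}"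
      by (auto simp: cdf_def measure_distr intro!: arg_cong[where f = prob])
    also have "\<dots> = spacing_cdf a k (c * x)" by (rule cdf)
    also have "ennreal \<dots> = emeasure D {..x}"
      using nn_integral_spacing_density(1)[OF assms(1-3), of x] by (simp add: D_def emeasure_density)
    then have "spacing_cdf a k (c * x) = cdf D x"
      unfolding cdf_def measure_def using spacing_cdf_nonneg[OF assms(1,2)] by (metis enn2real_ennreal)
    finally show ?thesis .
  qed
  then have "distr M borel Z = D"
    by (intro cdf_unique D real_distribution_distr ext) simp_all
  then have "distr M lborel Z = D"
    by (metis distr_cong sets_lborel)
  then show ?thesis
    unfolding distributed_def D_def by simp
qed

section \<open>Order statistics\<close>

definition ostat :: "'i set \<Rightarrow> nat \<Rightarrow> ('i \<Rightarrow> real) \<Rightarrow> real" where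
  "ostat I m y = sorted_list_of_multiset (image_mset y (mset_set I)) ! (m - 1)"

lemma order_stat_eq_ostat: "order_stat m n X \<omega> = ostat {..<n} m (\<lambda>i. X i \<omega>)"
proof -
  have "sort (map (\<lambda>i. X i \<omega>) [0..<n]) = sorted_list_of_multiset (mset (map (\<lambda>i. X i \<omega>) [0..<n]))"
    by (simp only: sorted_list_of_multiset_mset)
  also have "mset (map (\<lambda>i. X i \<omega>) [0..<n]) = image_mset (\<lambda>i. X i \<omega>) (mset_set {..<n})"
    by (simp add: lessThan_atLeast0)
  finally show ?thesis by (simp add: order_stat_def ostat_def)
qed

lemma sorted_nth_le_iff:
  fixes xs :: "'a :: linorder list"
  shows "sorted xs \<Longrightarrow> k < length xs \<Longrightarrow> xs ! k \<le> x \<longleftrightarrow> k < length (filter (\<lambda>v. v \<le> x) xs)"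
proof (induction xs arbitrary: k)
  case (Cons v xs)
  show ?case
  proof (cases "v \<le> x")
    case True
    then show ?thesis using Cons by (cases k) auto
  next
    case False
    have "v \<le> (v # xs) ! k" using Cons.prems by (cases k) auto
    moreover have "filter (\<lambda>v. v \<le> x) xs = []"
      using Cons.prems False by (auto simp: filter_empty_conv)
    ultimately show ?thesis using False by auto
  qed
qed simp

text \<open>The entries at most \<open>x\<close> form a prefix of the sorted list. Most later facts
  on order statistics use only this count, which also handles ties.\<close>

lemma ostat_le_iff:
  assumes "finite I" "1 \<le> m" "m \<le> card I"
  shows "ostat I m y \<le> x \<longleftrightarrow> m \<le> card {i \<in> I. y i \<le> x}"
proof -
  define xs where "xs = sorted_list_of_multiset (image_mset y (mset_set I))"
  have mset: "mset xs = image_mset y (mset_set I)" by (simp add: xs_def)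
  have "length xs = card I"
    using arg_cong[OF mset, of size] by simp
  moreover have "length (filter (\<lambda>v. v \<le> x) xs) = card {i \<in> I. y i \<le> x}"
  proof -
    have "length (filter (\<lambda>v. v \<le> x) xs) = size (filter_mset (\<lambda>v. v \<le> x) (mset xs))"
      by (metis mset_filter size_mset)
    then show ?thesis
      using \<open>finite I\<close> by (simp add: mset filter_mset_image_mset)
  qed
  moreover have "sorted xs" by (simp add: xs_def)
  ultimately show ?thesis
    using sorted_nth_le_iff[of xs "m - 1" x] assms unfolding ostat_def xs_def[symmetric] by auto
qed

lemma ostat_cong: "finite I \<Longrightarrow> (\<And>i. i \<in> I \<Longrightarrow> y i = z i) \<Longrightarrow> ostat I m y = ostat I m z"
  unfolding ostat_def by (rule arg_cong[where f = "\<lambda>A. sorted_list_of_multiset A ! (m - 1)"], rule image_mset_cong) simp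

lemma eq_if_same_upper_bounds: "(\<And>x. a \<le> x \<longleftrightarrow> b \<le> x) \<Longrightarrow> a = (b :: real)"
  by (meson antisym order_refl)

lemma ostat_mono_rank:
  assumes "finite I" "1 \<le> m" "m \<le> m'" "m' \<le> card I"
  shows "ostat I m y \<le> ostat I m' y"
  using assms ostat_le_iff[of I m y "ostat I m' y"] ostat_le_iff[of I m' y "ostat I m' y"] by auto

lemma ostat_mono_image:
  assumes "mono g" "finite I" "1 \<le> m" "m \<le> card I"
  shows "ostat I m (\<lambda>i. g (y i)) = g (ostat I m y)"
proof -
  define xs where "xs = sorted_list_of_multiset (image_mset y (mset_set I))"
  have mset: "mset xs = image_mset y (mset_set I)" by (simp add: xs_def)
  have "sorted (map g xs)"
    using \<open>mono g\<close> sorted_sorted_list_of_multiset[of "image_mset y (mset_set I)"]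
    unfolding xs_def[symmetric] sorted_map mono_def by (auto intro: sorted_wrt_mono_rel[rotated])
  then have "sorted_list_of_multiset (mset (map g xs)) = map g xs"
    by (simp only: sorted_list_of_multiset_mset sorted_sort_id)
  moreover have "mset (map g xs) = image_mset (\<lambda>i. g (y i)) (mset_set I)"
    by (simp add: mset multiset.map_comp comp_def)
  moreover have "length xs = card I"
    using arg_cong[OF mset, of size] by simp
  ultimately show ?thesis
    using assms unfolding ostat_def xs_def[symmetric] by simp
qed

lemma ostat_1_insert_least:
  assumes "finite J" "a \<notin> J" "\<And>i. i \<in> J \<Longrightarrow> y a < y i"
  shows "ostat (insert a J) 1 y = y a"
proof (rule eq_if_same_upper_bounds)
  fix x
  have "1 \<le> card {i \<in> insert a J. y i \<le> x} \<longleftrightarrow> {i \<in> insert a J. y i \<le> x} \<noteq> {}"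
    using assms by (simp add: Suc_le_eq card_gt_0_iff)
  also have "\<dots> \<longleftrightarrow> y a \<le> x"
    using assms(3) by (auto dest: less_le_trans intro: less_imp_le)
  finally show "ostat (insert a J) 1 y \<le> x \<longleftrightarrow> y a \<le> x"
    using assms by (subst ostat_le_iff) (auto simp: Suc_le_eq)
qed

text \<open>A strict minimum is counted as soon as any other value is, so removing it lowers every
  other rank by one.\<close>

lemma ostat_Suc_insert_least:
  assumes "finite J" "a \<notin> J" "\<And>i. i \<in> J \<Longrightarrow> y a < y i" "1 \<le> m" "m \<le> card J"
  shows "ostat (insert a J) (Suc m) y = ostat J m y"
proof (rule eq_if_same_upper_bounds)
  fix x
  have "Suc m \<le> card {i \<in> insert a J. y i \<le> x} \<longleftrightarrow> m \<le> card {i \<in> J. y i \<le> x}"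
  proof (cases "y a \<le> x")
    case True
    then have "{i \<in> insert a J. y i \<le> x} = insert a {i \<in> J. y i \<le> x}" by auto
    then show ?thesis using assms by simp
  next
    case False
    then have *: "{i \<in> insert a J. y i \<le> x} = {}" "{i \<in> J. y i \<le> x} = {}"
      using assms(3) by fastforce+
    show ?thesis unfolding * using assms(4) by simp
  qed
  then show "ostat (insert a J) (Suc m) y \<le> x \<longleftrightarrow> ostat J m y \<le> x"
    using assms by (simp add: ostat_le_iff)
qed

lemma borel_measurable_ostat [measurable (raw)]:
  assumes "finite I" "1 \<le> m" "m \<le> card I" and [measurable]: "\<And>i. i \<in> I \<Longrightarrow> Y i \<in> borel_measurable M"
  shows "(\<lambda>\<omega>. ostat I m (\<lambda>i. Y i \<omega>)) \<in> borel_measurable M"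
proof (rule borel_measurableI_le)
  fix x
  \<comment> \<open>Rewriting the count as a real sum of indicators makes its measurability
    automatic.\<close>
  have "real (card {i \<in> I. Y i \<omega> \<le> x}) = (\<Sum>i\<in>I. if Y i \<omega> \<le> x then 1 else 0)" for \<omega>
    using \<open>finite I\<close> by (simp add: sum.If_cases Int_def)
  then have "{\<omega> \<in> space M. ostat I m (\<lambda>i. Y i \<omega>) \<le> x}
      = {\<omega> \<in> space M. real m \<le> (\<Sum>i\<in>I. if Y i \<omega> \<le> x then 1 else 0)}"
    unfolding ostat_le_iff[OF assms(1-3)] by (simp only: of_nat_le_iff[symmetric, where 'a = real])
  also have "\<dots> \<in> sets M" by measurable
  finally show "{\<omega> \<in> space M. ostat I m (\<lambda>i. Y i \<omega>) \<le> x} \<in> sets M" .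
qed

section \<open>Spacings of exponential order statistics\<close>

lemma pred_card_le [measurable (raw)]:
  assumes "finite I" and [measurable]: "\<And>i. i \<in> I \<Longrightarrow> Y i \<in> borel_measurable M"
  shows "Measurable.pred M (\<lambda>\<omega>. card {i \<in> I. Y i \<omega> \<le> (x::real)} < m)"
proof -
  have *: "real (card {i \<in> I. Y i \<omega> \<le> x}) = (\<Sum>i\<in>I. if Y i \<omega> \<le> x then 1 else 0)" for \<omega>
    using \<open>finite I\<close> by (simp add: sum.If_cases Int_def)
  have "Measurable.pred M (\<lambda>\<omega>. (\<Sum>i\<in>I. if Y i \<omega> \<le> x then 1 else 0) < real m)"
    by measurable
  then show ?thesis unfolding *[symmetric] by simp
qed

text \<open>The number of coordinates at most \<open>x\<close> is binomial. Integrating out one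
  coordinate and splitting on whether it is at most \<open>x\<close> reproduces
  \<open>binom_lower_Suc_Suc\<close>. The integral of an indicator spares intersecting the event
  with the space of extensional functions.\<close>

lemma nn_integral_PiM_count:
  fixes \<nu> :: "real measure"
  assumes "prob_space \<nu>" and [measurable_cong]: "sets \<nu> = sets borel" and "finite J"
    and p: "p = measure \<nu> {..x}"
  shows "(\<integral>\<^sup>+y. indicator {y. card {i \<in> J. y i \<le> x} < m} y \<partial>PiM J (\<lambda>_. \<nu>)) = ennreal (binom_lower (card J) m p)"
  using \<open>finite J\<close>
proof (induction J arbitrary: m rule: finite_induct)
  case empty
  interpret prob_space \<nu> by fact
  interpret product_prob_space "\<lambda>_. \<nu>" "{}" ..
  show ?case
    by (cases m) (auto simp: binom_lower_no_trials PiM_empty nn_integral_count_space_finite)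
next
  case (insert a J)
  interpret prob_space \<nu> by fact
  interpret product_sigma_finite "\<lambda>_. \<nu>" ..
  have pr: "0 \<le> p" "p \<le> 1" by (simp_all add: p)
  have [measurable]: "{..x} \<in> sets \<nu>" "{x<..} \<in> sets \<nu>" by (simp_all add: assms(2))
  have sp: "space \<nu> = UNIV" using sets_eq_imp_space_eq[OF assms(2)] by simp
  have q: "emeasure \<nu> {x<..} = ennreal (1 - p)" "emeasure \<nu> {..x} = ennreal p"
  proof -
    have "{x<..} = space \<nu> - {..x}" by (auto simp: sp)
    then show "emeasure \<nu> {x<..} = ennreal (1 - p)" by (simp add: emeasure_eq_measure prob_compl p)
  qed (simp add: emeasure_eq_measure p)
  have meas: "(\<lambda>y. indicator {y. card {i \<in> I. y i \<le> x} < m} y :: ennreal) \<in> borel_measurable (PiM I (\<lambda>_. \<nu>))"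
    if "finite I" for I :: "'a set" and m
    unfolding indicator_def of_bool_def mem_Collect_eq using that by measurable
  note [measurable] = meas[OF insert.hyps(1)]
  show ?case
  proof (cases m)
    case 0
    then show ?thesis by simp
  next
    case (Suc l)
    have split: "indicator {y. card {i \<in> insert a J. y i \<le> x} < m} (y(a := z)) =
        indicator {..x} z * indicator {y. card {i \<in> J. y i \<le> x} < l} y
        + (indicator {x<..} z * indicator {y. card {i \<in> J. y i \<le> x} < m} y :: ennreal)" for y z
    proof -
      have "{i \<in> insert a J. (y(a := z)) i \<le> x} = (if z \<le> x then insert a {i \<in> J. y i \<le> x} else {i \<in> J. y i \<le> x})"
        using insert.hyps by auto
      then show ?thesis
        using insert.hyps by (auto simp: Suc split: split_indicator)
    qed
    have "(\<integral>\<^sup>+y. indicator {y. card {i \<in> insert a J. y i \<le> x} < m} y \<partial>PiM (insert a J) (\<lambda>_. \<nu>))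
        = (\<integral>\<^sup>+y. (\<integral>\<^sup>+z. indicator {y. card {i \<in> insert a J. y i \<le> x} < m} (y(a := z)) \<partial>\<nu>) \<partial>PiM J (\<lambda>_. \<nu>))"
      using insert.hyps by (intro product_nn_integral_insert meas) simp_all
    also have "\<dots> = (\<integral>\<^sup>+y. (ennreal p * indicator {y. card {i \<in> J. y i \<le> x} < l} y
          + ennreal (1 - p) * indicator {y. card {i \<in> J. y i \<le> x} < m} y) \<partial>PiM J (\<lambda>_. \<nu>))"
      unfolding split by (simp add: nn_integral_add nn_integral_multc q)
    also have "\<dots> = ennreal p * (\<integral>\<^sup>+y. indicator {y. card {i \<in> J. y i \<le> x} < l} y \<partial>PiM J (\<lambda>_. \<nu>))
        + ennreal (1 - p) * (\<integral>\<^sup>+y. indicator {y. card {i \<in> J. y i \<le> x} < m} y \<partial>PiM J (\<lambda>_. \<nu>))"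
      by (simp add: nn_integral_add nn_integral_cmult)
    also have "\<dots> = ennreal (binom_lower (card (insert a J)) m p)"
      using insert.hyps pr
      by (simp add: insert.IH Suc binom_lower_Suc_Suc binom_lower_nonneg ac_simps flip: ennreal_mult ennreal_plus)
    finally show ?thesis .
  qed
qed

section \<open>The standard exponential law and its memorylessness\<close>

definition exp1 :: "real measure" where
  "exp1 = density lborel (exponential_density 1)"

lemma sets_exp1 [simp, measurable_cong]: "sets exp1 = sets borel" "space exp1 = UNIV"
  by (simp_all add: exp1_def)

interpretation exp1: prob_space exp1
  unfolding exp1_def by (rule prob_space_exponential_density) simp

interpretation PiM_exp1: product_sigma_finite "\<lambda>_. exp1" ..

lemma AE_exp1_nonneg: "AE y in exp1. 0 \<le> y"
  unfolding exp1_def by (subst AE_density) (auto simp: exponential_density_def)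

lemma measure_exp1_atMost: "measure exp1 {..x} = max 0 (1 - exp (- x))"
proof -
  have "emeasure exp1 {..x} = ennreal (max 0 (1 - exp (- x)))"
    unfolding exp1_def by (subst emeasure_erlang_density) (auto simp: erlang_CDF_def max_def)
  then show ?thesis
    unfolding measure_def by (simp only: enn2real_ennreal max.cobounded1)
qed

text \<open>exp(-y)^n is the chance that n further observations exceed y, so this is the chance that
  a given one of n + 1 observations is the least.\<close>

lemma nn_integral_exp1_exp: "(\<integral>\<^sup>+y. ennreal (exp (- y)) ^ n \<partial>exp1) = ennreal (1 / (real n + 1))"
proof -
  let ?l = "real n + 1"
  have "(\<integral>\<^sup>+y. ennreal (exp (- y)) ^ n \<partial>exp1)
      = (\<integral>\<^sup>+y. ennreal (exponential_density 1 y) * ennreal (exp (- y)) ^ n \<partial>lborel)"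
    unfolding exp1_def by (subst nn_integral_density) auto
  also have "\<dots> = (\<integral>\<^sup>+y. ennreal (1 / ?l) * ennreal (exponential_density ?l y) \<partial>lborel)"
  proof (rule nn_integral_cong)
    fix y :: real
    have "exponential_density 1 y * exp (- y) ^ n = 1 / ?l * exponential_density ?l y"
    proof -
      have "exp (- y) * exp (- y) ^ n = exp (- (y * ?l))"
        by (simp add: algebra_simps flip: exp_of_nat_mult exp_add)
      then show ?thesis by (simp add: exponential_density_def)
    qed
    then show "ennreal (exponential_density 1 y) * ennreal (exp (- y)) ^ n
        = ennreal (1 / ?l) * ennreal (exponential_density ?l y)"
      by (simp add: ennreal_power flip: ennreal_mult)
  qed
  also have "\<dots> = ennreal (1 / ?l) * (\<integral>\<^sup>+y. ennreal (exponential_density ?l y) \<partial>lborel)"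
    by (rule nn_integral_cmult) simp
  also have "(\<integral>\<^sup>+y. ennreal (exponential_density ?l y) \<partial>lborel) = 1"
    using nn_integral_erlang_ith_moment[of ?l 0 0] by simp
  finally show ?thesis by simp
qed

lemma exp1_memoryless:
  assumes [measurable]: "h \<in> borel_measurable borel" and "y \<ge> 0"
  shows "(\<integral>\<^sup>+z. indicator {y<..} z * h (z - y) \<partial>exp1) = ennreal (exp (- y)) * (\<integral>\<^sup>+z. h z \<partial>exp1)"
proof -
  have "(\<integral>\<^sup>+z. indicator {y<..} z * h (z - y) \<partial>exp1)
      = (\<integral>\<^sup>+z. ennreal (exponential_density 1 z) * (indicator {y<..} z * h (z - y)) \<partial>lborel)"
    unfolding exp1_def by (subst nn_integral_density) auto
  also have "\<dots> = (\<integral>\<^sup>+z. ennreal (exponential_density 1 (y + z)) * (indicator {y<..} (y + z) * h z) \<partial>lborel)"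
    by (subst nn_integral_real_affine[where c = 1 and t = y]) auto
  also have "\<dots> = (\<integral>\<^sup>+z. ennreal (exp (- y)) * (ennreal (exponential_density 1 z) * h z) \<partial>lborel)"
  proof (rule nn_integral_cong_AE)
    \<comment> \<open>At z = 0 the strict indicator on the left vanishes, but the exponential
      density on the right does not.\<close>
    show "AE z in lborel. ennreal (exponential_density 1 (y + z)) * (indicator {y<..} (y + z) * h z)
        = ennreal (exp (- y)) * (ennreal (exponential_density 1 z) * h z)"
      using AE_lborel_singleton[of "0::real"]
    proof eventually_elim
      case (elim z)
      show ?case
      proof (cases "z > 0")
        case True
        have "exponential_density 1 (y + z) = exp (- y) * exponential_density 1 z"
          using True \<open>y \<ge> 0\<close> by (simp add: exponential_density_def flip: exp_add)
        then show ?thesis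
          using True by (simp add: ennreal_mult mult.assoc)
      qed (use elim in \<open>simp add: exponential_density_def\<close>)
    qed
  qed
  also have "\<dots> = ennreal (exp (- y)) * (\<integral>\<^sup>+z. ennreal (exponential_density 1 z) * h z \<partial>lborel)"
    by (rule nn_integral_cmult) simp
  also have "(\<integral>\<^sup>+z. ennreal (exponential_density 1 z) * h z \<partial>lborel) = (\<integral>\<^sup>+z. h z \<partial>exp1)"
    unfolding exp1_def by (subst nn_integral_density) auto
  finally show ?thesis .
qed

text \<open>Given that all coordinates exceed \<open>y\<close>, their excesses form a fresh
  exponential sample, and each coordinate contributes a factor exp(-y). The induction varies
  \<open>g\<close>, because the hypothesis is applied to the integral of \<open>g\<close> over one
  coordinate.\<close>

lemma PiM_exp1_memoryless:
  assumes "finite J" "g \<in> borel_measurable (PiM J (\<lambda>_. exp1))" "y \<ge> 0"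
  shows "(\<integral>\<^sup>+z. indicator {z. \<forall>i\<in>J. y < z i} z * g (\<lambda>i\<in>J. z i - y) \<partial>PiM J (\<lambda>_. exp1))
      = ennreal (exp (- y)) ^ card J * (\<integral>\<^sup>+z. g z \<partial>PiM J (\<lambda>_. exp1))"
  using assms(1,2)
proof (induction J arbitrary: g rule: finite_induct)
  case empty
  show ?case by (simp add: PiM_empty nn_integral_count_space_finite restrict_def)
next
  case (insert a J)
  note [measurable] = insert.prems
  have shift: "(\<lambda>z. (\<lambda>i\<in>I. z i - y)) \<in> PiM I (\<lambda>_. exp1) \<rightarrow>\<^sub>M PiM I (\<lambda>_. exp1)" for I :: "'a set"
    by (intro measurable_restrict) (simp add: sets_eq_imp_space_eq measurable_cong_sets[OF refl sets_exp1(1)])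
  note [measurable] = shift[of J] shift[of "insert a J"]
  have ind: "Measurable.pred (PiM I (\<lambda>_. exp1)) (\<lambda>z. \<forall>i\<in>I. y < z i)" if "finite I" for I :: "'a set"
    using that by measurable
  note [measurable] = ind[of J] ind[of "insert a J"]
  note [simp] = \<open>finite J\<close>
  have upd: "(\<lambda>i\<in>insert a J. (z(a := w)) i - y) = (\<lambda>i\<in>J. z i - y)(a := w - y)" for z w
    using insert.hyps by (auto simp: fun_eq_iff)
  have iff: "(\<forall>i\<in>insert a J. y < (z(a := w)) i) \<longleftrightarrow> y < w \<and> (\<forall>i\<in>J. y < z i)" for z w
    using insert.hyps by auto
  have sect: "(\<lambda>w. g (u(a := w))) \<in> borel_measurable borel" if "u \<in> space (PiM J (\<lambda>_. exp1))" for u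
    using that by measurable
  have "(\<integral>\<^sup>+z. indicator {z. \<forall>i\<in>insert a J. y < z i} z * g (\<lambda>i\<in>insert a J. z i - y) \<partial>PiM (insert a J) (\<lambda>_. exp1))
    = (\<integral>\<^sup>+z. (\<integral>\<^sup>+w. indicator {z. \<forall>i\<in>insert a J. y < z i} (z(a := w)) * g (\<lambda>i\<in>insert a J. (z(a := w)) i - y) \<partial>exp1) \<partial>PiM J (\<lambda>_. exp1))"
    using insert.hyps by (intro PiM_exp1.product_nn_integral_insert) auto
  also have "\<dots> = (\<integral>\<^sup>+z. indicator {z. \<forall>i\<in>J. y < z i} z * (ennreal (exp (- y)) * (\<integral>\<^sup>+w. g ((\<lambda>i\<in>J. z i - y)(a := w)) \<partial>exp1)) \<partial>PiM J (\<lambda>_. exp1))"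
  proof (rule nn_integral_cong)
    fix z assume z: "z \<in> space (PiM J (\<lambda>_. exp1))"
    have u: "(\<lambda>i\<in>J. z i - y) \<in> space (PiM J (\<lambda>_. exp1))"
      using measurable_space[OF shift z] .
    have "(\<integral>\<^sup>+w. indicator {z. \<forall>i\<in>insert a J. y < z i} (z(a := w)) * g (\<lambda>i\<in>insert a J. (z(a := w)) i - y) \<partial>exp1)
      = (\<integral>\<^sup>+w. indicator {z. \<forall>i\<in>J. y < z i} z * (indicator {y<..} w * g ((\<lambda>i\<in>J. z i - y)(a := w - y))) \<partial>exp1)"
      unfolding upd indicator_def mem_Collect_eq iff by (intro nn_integral_cong) auto
    also have "\<dots> = indicator {z. \<forall>i\<in>J. y < z i} z * (\<integral>\<^sup>+w. indicator {y<..} w * g ((\<lambda>i\<in>J. z i - y)(a := w - y)) \<partial>exp1)"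
      using sect[OF u] by (intro nn_integral_cmult) measurable
    also have "(\<integral>\<^sup>+w. indicator {y<..} w * g ((\<lambda>i\<in>J. z i - y)(a := w - y)) \<partial>exp1)
        = ennreal (exp (- y)) * (\<integral>\<^sup>+w. g ((\<lambda>i\<in>J. z i - y)(a := w)) \<partial>exp1)"
      by (rule exp1_memoryless[OF sect[OF u] \<open>y \<ge> 0\<close>])
    finally show "(\<integral>\<^sup>+w. indicator {z. \<forall>i\<in>insert a J. y < z i} (z(a := w)) * g (\<lambda>i\<in>insert a J. (z(a := w)) i - y) \<partial>exp1)
      = indicator {z. \<forall>i\<in>J. y < z i} z * (ennreal (exp (- y)) * (\<integral>\<^sup>+w. g ((\<lambda>i\<in>J. z i - y)(a := w)) \<partial>exp1))" .
  qed
  also have "\<dots> = ennreal (exp (- y)) ^ card J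
      * (\<integral>\<^sup>+z. ennreal (exp (- y)) * (\<integral>\<^sup>+w. g (z(a := w)) \<partial>exp1) \<partial>PiM J (\<lambda>_. exp1))"
    by (rule insert.IH) measurable
  also have "(\<integral>\<^sup>+z. ennreal (exp (- y)) * (\<integral>\<^sup>+w. g (z(a := w)) \<partial>exp1) \<partial>PiM J (\<lambda>_. exp1))
      = ennreal (exp (- y)) * (\<integral>\<^sup>+z. (\<integral>\<^sup>+w. g (z(a := w)) \<partial>exp1) \<partial>PiM J (\<lambda>_. exp1))"
    by (rule nn_integral_cmult) measurable
  also have "(\<integral>\<^sup>+z. (\<integral>\<^sup>+w. g (z(a := w)) \<partial>exp1) \<partial>PiM J (\<lambda>_. exp1)) = (\<integral>\<^sup>+z. g z \<partial>PiM (insert a J) (\<lambda>_. exp1))"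
    using insert.hyps by (intro PiM_exp1.product_nn_integral_insert[symmetric]) auto
  finally show ?case
    using insert.hyps by (simp add: mult_ac)
qed

section \<open>Deleting the least observation\<close>

lemma nn_integral_PiM_exp1_const: "finite J \<Longrightarrow> (\<integral>\<^sup>+y. 1 \<partial>PiM J (\<lambda>_. exp1)) = 1"
proof -
  interpret product_prob_space "\<lambda>_. exp1" J ..
  show ?thesis using P.emeasure_space_1 by simp
qed

text \<open>Split according to the index \<open>a\<close> of the strict minimum. There \<phi> sees
  only the excesses of the others over the minimum, through \<open>\<psi> a\<close>. By
  memorylessness each \<open>a\<close> contributes c / card J, and these add up to
  \<open>c\<close>.\<close>

lemma nn_integral_PiM_exp1_remove_least:
  fixes J :: "'i set"
  assumes J: "finite J" "J \<noteq> {}"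
    and \<phi> [measurable]: "\<phi> \<in> borel_measurable (PiM J (\<lambda>_. exp1))"
    and \<psi>: "\<And>a. a \<in> J \<Longrightarrow> \<psi> a \<in> borel_measurable (PiM (J - {a}) (\<lambda>_. exp1))"
    and eq: "\<And>a y z. a \<in> J \<Longrightarrow> (\<forall>i\<in>J - {a}. y < z i) \<Longrightarrow> \<phi> (z(a := y)) = \<psi> a (\<lambda>i\<in>J - {a}. z i - y)"
    and const: "\<And>a. a \<in> J \<Longrightarrow> (\<integral>\<^sup>+z. \<psi> a z \<partial>PiM (J - {a}) (\<lambda>_. exp1)) = c"
  shows "(\<integral>\<^sup>+y. \<phi> y \<partial>PiM J (\<lambda>_. exp1)) = c"
proof -
  define P where "P = PiM J (\<lambda>_. exp1)"
  define S :: "'i \<Rightarrow> ('i \<Rightarrow> real) set" where "S a = {y. \<forall>i\<in>J - {a}. y a < y i}" for a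
  have comp: "(\<lambda>y. y i) \<in> borel_measurable P" if "i \<in> J" for i
    using measurable_component_singleton[OF that, of "\<lambda>_. exp1"]
    by (simp add: P_def measurable_cong_sets[OF refl sets_exp1(1)])
  have S_pred: "Measurable.pred P (\<lambda>y. \<forall>i\<in>J - {a}. y a < y i)" if "a \<in> J" for a
    using that J by (intro pred_intros_finite borel_measurable_pred_less comp) auto
  have S_meas: "(\<lambda>y. indicator (S a) y :: ennreal) \<in> borel_measurable P" if "a \<in> J" for a
    unfolding S_def indicator_def of_bool_def mem_Collect_eq using S_pred[OF that] by measurable
  have disj: "S a \<inter> S b = {}" if "a \<in> J" "b \<in> J" "a \<noteq> b" for a b
  proof (rule equals0I)
    fix y assume "y \<in> S a \<inter> S b"
    then have "y a < y b" "y b < y a" using that by (auto simp: S_def)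
    then show False by simp
  qed

  \<comment> \<open>Stated for general \<open>f\<close> and \<open>g\<close> because it is applied
    twice: to the constant 1, which gives the events \<open>S a\<close> their probabilities, and to
    \<phi>. The factor exp(-y) to the power \<open>card I\<close> comes from the others exceeding y,
    and averages to 1 / card J.\<close>
  have least: "(\<integral>\<^sup>+y. f y * indicator (S a) y \<partial>P) = ennreal (1 / real (card J)) * d"
    if "a \<in> J" and [measurable]: "f \<in> borel_measurable P"
      and g [measurable]: "g \<in> borel_measurable (PiM (J - {a}) (\<lambda>_. exp1))"
      and fg: "\<And>y z. (\<forall>i\<in>J - {a}. y < z i) \<Longrightarrow> f (z(a := y)) = g (\<lambda>i\<in>J - {a}. z i - y)"
      and d: "(\<integral>\<^sup>+z. g z \<partial>PiM (J - {a}) (\<lambda>_. exp1)) = d"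
    for a d and f g :: "('i \<Rightarrow> real) \<Rightarrow> ennreal"
  proof -
    define I where "I = J - {a}"
    have I: "finite I" "a \<notin> I" "J = insert a I" "card J = Suc (card I)"
      unfolding I_def using J \<open>a \<in> J\<close> by (blast, blast, blast, metis card.remove)
    have "(\<integral>\<^sup>+y. f y * indicator (S a) y \<partial>P)
        = (\<integral>\<^sup>+y. (\<integral>\<^sup>+z. f (z(a := y)) * indicator (S a) (z(a := y)) \<partial>PiM I (\<lambda>_. exp1)) \<partial>exp1)"
      unfolding P_def I(3) using I(1,2) S_meas[OF \<open>a \<in> J\<close>] that(2)
      by (intro PiM_exp1.product_nn_integral_insert_rev borel_measurable_times)
         (simp_all add: P_def flip: I(3))
    also have "\<dots> = (\<integral>\<^sup>+y. ennreal (exp (- y)) ^ card I * d \<partial>exp1)"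
    proof (rule nn_integral_cong_AE)
      show "AE y in exp1. (\<integral>\<^sup>+z. f (z(a := y)) * indicator (S a) (z(a := y)) \<partial>PiM I (\<lambda>_. exp1))
          = ennreal (exp (- y)) ^ card I * d"
        using AE_exp1_nonneg
      proof eventually_elim
        case (elim y)
        have "(\<integral>\<^sup>+z. f (z(a := y)) * indicator (S a) (z(a := y)) \<partial>PiM I (\<lambda>_. exp1))
          = (\<integral>\<^sup>+z. indicator {z. \<forall>i\<in>I. y < z i} z * g (\<lambda>i\<in>I. z i - y) \<partial>PiM I (\<lambda>_. exp1))"
        proof (rule nn_integral_cong)
          fix z
          have "z(a := y) \<in> S a \<longleftrightarrow> (\<forall>i\<in>I. y < z i)"
            by (auto simp: S_def I_def)
          then show "f (z(a := y)) * indicator (S a) (z(a := y))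
              = indicator {z. \<forall>i\<in>I. y < z i} z * g (\<lambda>i\<in>I. z i - y)"
            using fg[of y z] by (auto simp: I_def indicator_def)
        qed
        also have "\<dots> = ennreal (exp (- y)) ^ card I * (\<integral>\<^sup>+z. g z \<partial>PiM I (\<lambda>_. exp1))"
          using I(1) g elim unfolding I_def[symmetric] by (rule PiM_exp1_memoryless)
        finally show ?case using d by (simp add: I_def)
      qed
    qed
    also have "\<dots> = ennreal (1 / real (card J)) * d"
      by (simp add: nn_integral_multc nn_integral_exp1_exp I(4) add.commute)
    finally show ?thesis .
  qed

  have card: "(\<Sum>a\<in>J. ennreal (1 / real (card J)) * d) = d" for d
  proof -
    have "of_nat (card J) * ennreal (1 / real (card J)) = 1"
      using J by (simp add: ennreal_of_nat_eq_real_of_nat flip: ennreal_mult)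
    then show ?thesis by (simp flip: mult.assoc)
  qed
  have ind: "(\<Sum>a\<in>J. indicator (S a) y :: ennreal) = indicator (\<Union>a\<in>J. S a) y" for y
    using J disj by (intro indicator_UN_disjoint[symmetric]) (auto simp: disjoint_family_on_def)
  have U_sets: "{y \<in> space P. y \<in> (\<Union>a\<in>J. S a)} \<in> sets P"
    using J S_pred unfolding S_def UN_iff mem_Collect_eq by measurable
  \<comment> \<open>The events \<open>S a\<close> are disjoint with total probability \<open>1\<close>, so ties need no separate treatment.\<close>
  have one: "(\<integral>\<^sup>+y. indicator (\<Union>a\<in>J. S a) y \<partial>P) = 1"
  proof -
    have "(\<integral>\<^sup>+y. indicator (\<Union>a\<in>J. S a) y \<partial>P) = (\<Sum>a\<in>J. \<integral>\<^sup>+y. 1 * indicator (S a) y \<partial>P)"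
      unfolding ind[symmetric] mult_1 by (rule nn_integral_sum[OF S_meas])
    also have "\<dots> = (\<Sum>a\<in>J. ennreal (1 / real (card J)) * 1)"
      using J by (intro sum.cong refl least[where g = "\<lambda>_. 1"]) (simp_all add: nn_integral_PiM_exp1_const del: nn_integral_const)
    finally show ?thesis unfolding card .
  qed
  interpret P: prob_space P
  proof -
    interpret product_prob_space "\<lambda>_. exp1" J ..
    show "prob_space P" unfolding P_def by (rule P.prob_space_axioms)
  qed
  have "AE y in P. y \<in> (\<Union>a\<in>J. S a)"
  proof -
    have "(\<integral>\<^sup>+y. indicator (\<Union>a\<in>J. S a) y \<partial>P) = (\<integral>\<^sup>+y. indicator {y \<in> space P. y \<in> (\<Union>a\<in>J. S a)} y \<partial>P)"
      by (intro nn_integral_cong) (auto split: split_indicator)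
    also have "\<dots> = emeasure P {y \<in> space P. y \<in> (\<Union>a\<in>J. S a)}"
      using U_sets by simp
    finally have "P.prob {y \<in> space P. y \<in> (\<Union>a\<in>J. S a)} = 1"
      using one by (simp add: measure_def)
    then show ?thesis
      using U_sets by (simp add: P.prob_Collect_eq_1)
  qed
  then have "(\<integral>\<^sup>+y. \<phi> y \<partial>P) = (\<integral>\<^sup>+y. (\<Sum>a\<in>J. \<phi> y * indicator (S a) y) \<partial>P)"
    by (intro nn_integral_cong_AE, eventually_elim) (simp add: ind flip: sum_distrib_left)
  also have "\<dots> = (\<Sum>a\<in>J. \<integral>\<^sup>+y. \<phi> y * indicator (S a) y \<partial>P)"
    using S_meas \<phi> by (intro nn_integral_sum) (simp add: P_def borel_measurable_times)
  also have "\<dots> = (\<Sum>a\<in>J. ennreal (1 / real (card J)) * c)"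
    using \<phi> \<psi> eq const by (intro sum.cong refl least) (auto simp: P_def)
  also have "\<dots> = c" by (rule card)
  finally show ?thesis by (simp add: P_def)
qed

text \<open>Rank \<open>0\<close> stands for the origin, so that the case \<open>i = 0\<close> is the distribution of a single order
  statistic and serves as the base of the induction.\<close>

lemma nn_integral_PiM_exp1_ostat_diff:
  fixes J :: "'i set"
  assumes "finite J" "i < j" "j \<le> card J" "x \<ge> 0"
  shows "(\<integral>\<^sup>+y. indicator {y. x < ostat J j y - (if i = 0 then 0 else ostat J i y)} y \<partial>PiM J (\<lambda>_. exp1))
    = ennreal (binom_lower (card J - i) (j - i) (1 - exp (- x)))"
  using assms(1-3)
proof (induction i arbitrary: j J)
  case 0
  have "ostat J j y \<le> x \<longleftrightarrow> j \<le> card {k \<in> J. y k \<le> x}" for y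
    using 0 by (intro ostat_le_iff) auto
  then have "x < ostat J j y \<longleftrightarrow> card {k \<in> J. y k \<le> x} < j" for y
    by (meson not_le)
  then show ?case
    using nn_integral_PiM_count[OF exp1.prob_space_axioms _ 0(1) refl, of x j] \<open>x \<ge> 0\<close>
    by (simp add: measure_exp1_atMost max_def)
next
  case (Suc i)
  define D where "D I i j y = ostat I j y - (if i = 0 then 0 else ostat I i y)"
    for I :: "'i set" and i j :: nat and y
  obtain j' where j: "j = Suc j'" "i < j'" using Suc.prems by (cases j) auto
  have meas: "(\<lambda>y. indicator {y. x < D I i j y} y :: ennreal) \<in> borel_measurable (PiM I (\<lambda>_. exp1))"
    if "finite I" "i < j" "j \<le> card I" for I :: "'i set" and i j
  proof -
    have comp: "(\<lambda>y. y k) \<in> borel_measurable (PiM I (\<lambda>_. exp1))" if "k \<in> I" for k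
      using measurable_component_singleton[OF that, of "\<lambda>_. exp1"]
      by (simp add: measurable_cong_sets[OF refl sets_exp1(1)])
    have o: "(\<lambda>y. ostat I m y) \<in> borel_measurable (PiM I (\<lambda>_. exp1))" if "1 \<le> m" "m \<le> card I" for m
      using \<open>finite I\<close> that comp by (rule borel_measurable_ostat)
    have "(\<lambda>y. D I i j y) \<in> borel_measurable (PiM I (\<lambda>_. exp1))"
      using o[of i] o[of j] that unfolding D_def by (cases "i = 0") (auto intro: borel_measurable_diff)
    then show ?thesis
      unfolding indicator_def of_bool_def mem_Collect_eq by measurable
  qed
  have "(\<integral>\<^sup>+y. indicator {y. x < D J (Suc i) (Suc j') y} y \<partial>PiM J (\<lambda>_. exp1))
      = ennreal (binom_lower (card J - Suc i) (j' - i) (1 - exp (- x)))"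
  proof (rule nn_integral_PiM_exp1_remove_least[where \<psi> = "\<lambda>a z. indicator {z. x < D (J - {a}) i j' z} z"])
    show "finite J" "J \<noteq> {}" using Suc.prems by auto
    show "(\<lambda>y. indicator {y. x < D J (Suc i) (Suc j') y} y :: ennreal) \<in> borel_measurable (PiM J (\<lambda>_. exp1))"
      using Suc.prems j by (intro meas) auto
    fix a assume a: "a \<in> J"
    define I where "I = J - {a}"
    have cI: "card J = Suc (card I)"
      unfolding I_def using Suc.prems(1) a by (rule card.remove)
    have I: "finite I" "a \<notin> I" "J = insert a I"
      using Suc.prems(1) a by (auto simp: I_def)
    have j': "j' \<le> card I" using Suc.prems(3) j(1) cI by linarith
    show "(\<lambda>z. indicator {z. x < D (J - {a}) i j' z} z :: ennreal) \<in> borel_measurable (PiM (J - {a}) (\<lambda>_. exp1))"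
      unfolding I_def[symmetric] by (rule meas[OF I(1) j(2) j'])
    show "(\<integral>\<^sup>+z. indicator {z. x < D (J - {a}) i j' z} z \<partial>PiM (J - {a}) (\<lambda>_. exp1))
        = ennreal (binom_lower (card J - Suc i) (j' - i) (1 - exp (- x)))"
      unfolding I_def[symmetric] D_def cI using Suc.IH[OF I(1) j(2) j'] by simp
    fix y and z :: "'i \<Rightarrow> real" assume "\<forall>i\<in>J - {a}. y < z i"
    then have z: "(z(a := y)) a < (z(a := y)) k" if "k \<in> I" for k
      using that I(2) by (auto simp: I_def)
    have shift: "ostat J (Suc m) (z(a := y)) = ostat I m (\<lambda>k\<in>I. z k - y) + y" if "1 \<le> m" "m \<le> card I" for m
    proof -
      have "ostat J (Suc m) (z(a := y)) = ostat I m (z(a := y))"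
        unfolding I(3) using I(1,2) z that by (rule ostat_Suc_insert_least)
      also have "\<dots> = ostat I m (\<lambda>k. (\<lambda>k\<in>I. z k - y) k + y)"
        using I(1,2) by (intro ostat_cong) auto
      also have "\<dots> = ostat I m (\<lambda>k\<in>I. z k - y) + y"
        using I(1) that by (intro ostat_mono_image) (auto simp: mono_def)
      finally show ?thesis .
    qed
    \<comment> \<open>For positive \<open>i\<close> the shift \<open>y\<close> cancels in the
      difference. For \<open>i = 0\<close> the subtracted order statistic is the deleted minimum
      itself, so the excess is measured from the origin.\<close>
    have "ostat J 1 (z(a := y)) = y"
      unfolding I(3) using ostat_1_insert_least[of I a "z(a := y)"] I(1,2) z by simp
    then have "D J (Suc i) (Suc j') (z(a := y)) = D I i j' (\<lambda>k\<in>I. z k - y)"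
      using shift[of i] shift[of j'] j' j(2) by (cases "i = 0") (simp_all add: D_def)
    then show "(indicator {y. x < D J (Suc i) (Suc j') y} (z(a := y)) :: ennreal)
        = indicator {z. x < D (J - {a}) i j' z} (\<lambda>k\<in>J - {a}. z k - y)"
      by (simp add: I_def indicator_def)
  qed
  then show ?case by (simp add: D_def j)
qed

section \<open>Samples\<close>

lemma iid_sample_distr:
  assumes "iid_sample M n F X" "n \<ge> 1" "real_distribution \<nu>" "cdf \<nu> = F"
  shows "distr M (PiM {..<n} (\<lambda>_. borel)) (\<lambda>\<omega>. \<lambda>i\<in>{..<n}. X i \<omega>) = PiM {..<n} (\<lambda>_. \<nu>)"
proof -
  interpret prob_space M using assms(1) by (simp add: iid_sample_def)
  have ind: "indep_vars (\<lambda>_. borel) X {..<n}" and F: "\<And>i. i < n \<Longrightarrow> cdf (distr M borel (X i)) = F"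
    using assms(1) by (auto simp: iid_sample_def)
  have X: "X i \<in> borel_measurable M" if "i < n" for i
    using ind that by (auto simp: indep_vars_def)
  have "distr M (PiM {..<n} (\<lambda>_. borel)) (\<lambda>\<omega>. \<lambda>i\<in>{..<n}. X i \<omega>) = PiM {..<n} (\<lambda>i. distr M borel (X i))"
    using ind X assms(2) by (subst (asm) indep_vars_iff_distr_eq_PiM') (auto simp: lessThan_empty_iff)
  also have "\<dots> = PiM {..<n} (\<lambda>_. \<nu>)"
    using X F assms by (intro PiM_cong refl cdf_unique real_distribution_distr) auto
  finally show ?thesis .
qed

lemma iid_sample_measurable:
  "iid_sample M n F X \<Longrightarrow> i < n \<Longrightarrow> X i \<in> borel_measurable M"
  by (auto simp: iid_sample_def prob_space.indep_vars_def)

lemma borel_measurable_order_stat: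
  assumes "iid_sample M n F X" "1 \<le> m" "m \<le> n"
  shows "order_stat m n X \<in> borel_measurable M"
proof -
  have "(\<lambda>\<omega>. ostat {..<n} m (\<lambda>i. X i \<omega>)) \<in> borel_measurable M"
    using assms iid_sample_measurable[OF assms(1)] by (intro borel_measurable_ostat) auto
  then show ?thesis by (simp add: order_stat_eq_ostat[abs_def])
qed

text \<open>Points of the product space are extensional, while
  \<open>\<lambda>i. X i \<omega>\<close> need not be. The hypothesis \<open>cong\<close> says that
  the event looks only at the first \<open>n\<close> coordinates, so restriction does not change
  it.\<close>

lemma emeasure_iid_sample:
  assumes "iid_sample M n F X" "n \<ge> 1" "real_distribution \<nu>" "cdf \<nu> = F"
    and P [measurable]: "Measurable.pred (PiM {..<n} (\<lambda>_. borel)) P"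
    and cong: "\<And>y z. (\<And>i. i < n \<Longrightarrow> y i = z i) \<Longrightarrow> P y \<longleftrightarrow> P z"
  shows "emeasure M {\<omega> \<in> space M. P (\<lambda>i. X i \<omega>)} = (\<integral>\<^sup>+y. indicator {y. P y} y \<partial>PiM {..<n} (\<lambda>_. \<nu>))"
proof -
  let ?f = "\<lambda>\<omega>. \<lambda>i\<in>{..<n}. X i \<omega>"
  have [measurable]: "?f \<in> M \<rightarrow>\<^sub>M PiM {..<n} (\<lambda>_. borel)"
    using iid_sample_measurable[OF assms(1)] by (intro measurable_restrict) auto
  have [measurable]: "(\<lambda>y. indicator {y. P y} y :: ennreal) \<in> borel_measurable (PiM {..<n} (\<lambda>_. borel))"
    unfolding indicator_def of_bool_def mem_Collect_eq by measurable
  have eq: "P (?f \<omega>) \<longleftrightarrow> P (\<lambda>i. X i \<omega>)" for \<omega>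
    by (rule cong) simp
  have [measurable]: "Measurable.pred M (\<lambda>\<omega>. P (\<lambda>i. X i \<omega>))"
    unfolding eq[symmetric] by measurable
  have "(\<integral>\<^sup>+y. indicator {y. P y} y \<partial>PiM {..<n} (\<lambda>_. \<nu>)) = (\<integral>\<^sup>+\<omega>. indicator {y. P y} (?f \<omega>) \<partial>M)"
    unfolding iid_sample_distr[OF assms(1-4), symmetric] by (subst nn_integral_distr) measurable
  also have "\<dots> = (\<integral>\<^sup>+\<omega>. indicator {\<omega> \<in> space M. P (\<lambda>i. X i \<omega>)} \<omega> \<partial>M)"
    using eq by (intro nn_integral_cong) (auto split: split_indicator)
  also have "\<dots> = emeasure M {\<omega> \<in> space M. P (\<lambda>i. X i \<omega>)}"
    by (rule nn_integral_indicator) measurable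
  finally show ?thesis ..
qed

lemma iid_sample_real_distribution:
  assumes "iid_sample M n F X" "n \<ge> 1"
  shows "\<exists>\<nu>. real_distribution \<nu> \<and> cdf \<nu> = F"
proof (intro exI conjI)
  interpret prob_space M using assms(1) by (simp add: iid_sample_def)
  show "real_distribution (distr M borel (X 0))"
    using iid_sample_measurable[OF assms(1)] assms(2) by (intro real_distribution_distr) simp
  show "cdf (distr M borel (X 0)) = F"
    using assms by (simp add: iid_sample_def)
qed

lemma prob_order_stat_le:
  assumes iid: "iid_sample M n F X" and m: "1 \<le> m" "m \<le> n"
  shows "measure M {\<omega> \<in> space M. order_stat m n X \<omega> \<le> x} = 1 - binom_lower n m (F x)"
proof -
  interpret prob_space M using iid by (simp add: iid_sample_def)
  have n: "n \<ge> 1" using m by simp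
  obtain \<nu> where \<nu>: "real_distribution \<nu>" "cdf \<nu> = F"
    using iid_sample_real_distribution[OF iid n] by blast
  interpret \<nu>: real_distribution \<nu> by fact
  have F: "F x = measure \<nu> {..x}" "0 \<le> F x" "F x \<le> 1"
    using \<nu>(2) by (auto simp: cdf_def)
  have "order_stat m n X \<omega> \<le> x \<longleftrightarrow> m \<le> card {i \<in> {..<n}. X i \<omega> \<le> x}" for \<omega>
    unfolding order_stat_eq_ostat using m by (intro ostat_le_iff) auto
  then have iff: "x < order_stat m n X \<omega> \<longleftrightarrow> card {i \<in> {..<n}. X i \<omega> \<le> x} < m" for \<omega>
    by (meson not_le)
  have "emeasure M {\<omega> \<in> space M. x < order_stat m n X \<omega>}
      = (\<integral>\<^sup>+y. indicator {y. card {i \<in> {..<n}. y i \<le> x} < m} y \<partial>PiM {..<n} (\<lambda>_. \<nu>))"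
    unfolding iff
  proof (rule emeasure_iid_sample[OF iid n \<nu>])
    show "Measurable.pred (PiM {..<n} (\<lambda>_. borel)) (\<lambda>y. card {i \<in> {..<n}. y i \<le> x} < m)"
      by (intro pred_card_le) auto
    show "card {i \<in> {..<n}. y i \<le> x} < m \<longleftrightarrow> card {i \<in> {..<n}. z i \<le> x} < m"
      if "\<And>i. i < n \<Longrightarrow> y i = z i" for y z :: "nat \<Rightarrow> real"
    proof -
      have "{i \<in> {..<n}. y i \<le> x} = {i \<in> {..<n}. z i \<le> x}" using that by auto
      then show ?thesis by simp
    qed
  qed
  also have "\<dots> = ennreal (binom_lower n m (F x))"
    using nn_integral_PiM_count[OF \<nu>.prob_space_axioms _ _ F(1), of "{..<n}" m] by simp
  finally have "prob {\<omega> \<in> space M. x < order_stat m n X \<omega>} = binom_lower n m (F x)"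
    using binom_lower_nonneg[OF F(2,3)] by (simp add: measure_def)
  then show ?thesis
    using prob_neg[of "\<lambda>\<omega>. x < order_stat m n X \<omega>"] borel_measurable_order_stat[OF iid m]
    by (simp add: not_less)
qed

lemma real_distribution_exp1: "real_distribution exp1"
  unfolding real_distribution_def real_distribution_axioms_def by (simp add: exp1.prob_space_axioms)

lemma prob_exponential_spacing_le:
  assumes iid: "iid_sample M n (\<lambda>x. max 0 (1 - exp (- x))) Y" and ij: "1 \<le> i" "i < j" "j \<le> n"
  shows "measure M {\<omega> \<in> space M. order_stat j n Y \<omega> - order_stat i n Y \<omega> \<le> x}
      = 1 - binom_lower (n - i) (j - i) (max 0 (1 - exp (- x)))"
proof -
  interpret prob_space M using iid by (simp add: iid_sample_def)
  have n: "n \<ge> 1" using ij by simp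
  have cdf: "cdf exp1 = (\<lambda>x. max 0 (1 - exp (- x)))"
    by (simp add: fun_eq_iff cdf_def measure_exp1_atMost)
  have [measurable]: "order_stat j n Y \<in> borel_measurable M" "order_stat i n Y \<in> borel_measurable M"
    using ij by (auto intro!: borel_measurable_order_stat[OF iid])
  show ?thesis
  proof (cases "x \<ge> 0")
    case True
    let ?P = "\<lambda>y. x < ostat {..<n} j y - ostat {..<n} i y"
    have "emeasure M {\<omega> \<in> space M. x < order_stat j n Y \<omega> - order_stat i n Y \<omega>}
        = (\<integral>\<^sup>+y. indicator {y. ?P y} y \<partial>PiM {..<n} (\<lambda>_. exp1))"
      unfolding order_stat_eq_ostat
    proof (rule emeasure_iid_sample[OF iid n real_distribution_exp1 cdf])
      show "Measurable.pred (PiM {..<n} (\<lambda>_. borel)) ?P"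
        using ij by (intro borel_measurable_pred_less borel_measurable_diff borel_measurable_const
            borel_measurable_ostat) auto
      show "?P y \<longleftrightarrow> ?P z" if "\<And>i. i < n \<Longrightarrow> y i = z i" for y z :: "nat \<Rightarrow> real"
        using ostat_cong[of "{..<n}" y z] that by simp
    qed
    also have "\<dots> = ennreal (binom_lower (n - i) (j - i) (1 - exp (- x)))"
      using nn_integral_PiM_exp1_ostat_diff[of "{..<n}" i j x] ij True by simp
    finally have "prob {\<omega> \<in> space M. x < order_stat j n Y \<omega> - order_stat i n Y \<omega>}
        = binom_lower (n - i) (j - i) (1 - exp (- x))"
      using binom_lower_nonneg[of "1 - exp (- x)"] True by (simp add: measure_def)
    then show ?thesis
      using prob_neg[of "\<lambda>\<omega>. x < order_stat j n Y \<omega> - order_stat i n Y \<omega>"] True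
      by (simp add: not_less max_def)
  next
    case False
    have mono: "order_stat i n Y \<omega> \<le> order_stat j n Y \<omega>" for \<omega>
      unfolding order_stat_eq_ostat using ij by (intro ostat_mono_rank) auto
    have "\<not> order_stat j n Y \<omega> - order_stat i n Y \<omega> \<le> x" for \<omega>
      using mono[of \<omega>] False by linarith
    then show ?thesis
      using False ij by (simp add: max_def binom_lower_at_0)
  qed
qed

lemma iid_sample_compose:
  assumes iid: "iid_sample M n F X" and [measurable]: "g \<in> borel_measurable borel"
    and G: "\<And>i x. i < n \<Longrightarrow> measure M {\<omega> \<in> space M. g (X i \<omega>) \<le> x} = G x"
  shows "iid_sample M n G (\<lambda>i \<omega>. g (X i \<omega>))"
proof -
  interpret prob_space M using iid by (simp add: iid_sample_def)
  have "indep_vars (\<lambda>_. borel) X {..<n}" using iid by (simp add: iid_sample_def)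
  then have "indep_vars (\<lambda>_. borel) (\<lambda>i \<omega>. g (X i \<omega>)) {..<n}"
    by (rule indep_vars_compose2) simp
  moreover have "cdf (distr M borel (\<lambda>\<omega>. g (X i \<omega>))) = G" if "i < n" for i
  proof
    fix x
    have [measurable]: "X i \<in> borel_measurable M" using iid_sample_measurable[OF iid that] .
    have "cdf (distr M borel (\<lambda>\<omega>. g (X i \<omega>))) x = prob {\<omega> \<in> space M. g (X i \<omega>) \<le> x}"
      by (auto simp: cdf_def measure_distr intro!: arg_cong[where f = prob])
    then show "cdf (distr M borel (\<lambda>\<omega>. g (X i \<omega>))) x = G x" using G[OF that] by simp
  qed
  ultimately show ?thesis
    by (simp add: iid_sample_def prob_space_axioms)
qed

lemma iid_sample_cdf:
  assumes "iid_sample M n F X" "i < n"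
  shows "measure M {\<omega> \<in> space M. X i \<omega> \<le> x} = F x"
proof -
  have [measurable]: "X i \<in> borel_measurable M" using iid_sample_measurable[OF assms] .
  have "measure M {\<omega> \<in> space M. X i \<omega> \<le> x} = cdf (distr M borel (X i)) x"
    by (auto simp: cdf_def measure_distr intro!: arg_cong[where f = "measure M"])
  then show ?thesis using assms by (simp add: iid_sample_def)
qed

section \<open>From Pareto to exponential observations\<close>

text \<open>The truncation at \<open>\<delta>\<close>, below which there are almost surely no observations, makes the map
  monotone on all reals, so that it commutes with order statistics everywhere.\<close>

definition pareto_log :: "real \<Rightarrow> real \<Rightarrow> real \<Rightarrow> real" where
  "pareto_log \<alpha> \<delta> x = \<alpha> * ln (max x \<delta> / \<delta>)"

lemma mono_pareto_log: "\<alpha> > 0 \<Longrightarrow> \<delta> > 0 \<Longrightarrow> mono (pareto_log \<alpha> \<delta>)"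
  by (auto simp: mono_def pareto_log_def divide_right_mono)

lemma pareto_log_le_iff:
  assumes "\<alpha> > 0" "\<delta> > 0"
  shows "pareto_log \<alpha> \<delta> x \<le> t \<longleftrightarrow> 0 \<le> t \<and> x \<le> \<delta> * exp (t / \<alpha>)"
proof -
  have pos: "max x \<delta> / \<delta> > 0" using assms by simp
  have "pareto_log \<alpha> \<delta> x \<le> t \<longleftrightarrow> ln (max x \<delta> / \<delta>) \<le> t / \<alpha>"
    using assms by (simp add: pareto_log_def field_simps)
  also have "\<dots> \<longleftrightarrow> max x \<delta> / \<delta> \<le> exp (t / \<alpha>)"
    using pos by (metis exp_le_cancel_iff exp_ln)
  also have "\<dots> \<longleftrightarrow> x \<le> \<delta> * exp (t / \<alpha>) \<and> 1 \<le> exp (t / \<alpha>)"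
    using assms by (simp add: pos_divide_le_eq mult.commute)
  also have "\<dots> \<longleftrightarrow> 0 \<le> t \<and> x \<le> \<delta> * exp (t / \<alpha>)"
    using assms by (auto simp: zero_le_divide_iff)
  finally show ?thesis .
qed

lemma iid_sample_pareto_log:
  assumes "\<alpha> > 0" "\<delta> > 0" and iid: "iid_sample M n (pareto_cdf \<alpha> \<delta>) X"
  shows "iid_sample M n (\<lambda>x. max 0 (1 - exp (- x))) (\<lambda>i \<omega>. pareto_log \<alpha> \<delta> (X i \<omega>))"
proof (rule iid_sample_compose[OF iid])
  show "pareto_log \<alpha> \<delta> \<in> borel_measurable borel"
    unfolding pareto_log_def[abs_def] by measurable
  fix i t assume i: "i < n"
  show "measure M {\<omega> \<in> space M. pareto_log \<alpha> \<delta> (X i \<omega>) \<le> t} = max 0 (1 - exp (- t))"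
  proof (cases "t \<ge> 0")
    case True
    have "measure M {\<omega> \<in> space M. pareto_log \<alpha> \<delta> (X i \<omega>) \<le> t} = pareto_cdf \<alpha> \<delta> (\<delta> * exp (t / \<alpha>))"
      using iid_sample_cdf[OF iid i] True assms by (simp add: pareto_log_le_iff)
    also have "\<dots> = 1 - exp (- t)"
    \<comment> \<open>At t = 0 the argument is \<delta> itself, where \<open>pareto_cdf\<close>
      takes its zero branch.\<close>
    proof (cases "t = 0")
      case False
      then have "1 < exp (t / \<alpha>)" using True assms by simp
      then have "\<not> \<delta> * exp (t / \<alpha>) \<le> \<delta>" using assms by simp
      moreover have "(\<delta> / (\<delta> * exp (t / \<alpha>))) powr \<alpha> = exp (- t)"
        using assms by (simp add: exp_powr_real flip: exp_minus inverse_eq_divide)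
      ultimately show ?thesis by (simp add: pareto_cdf_def)
    qed (simp add: pareto_cdf_def)
    finally show ?thesis using True by (simp add: max_def)
  next
    case False
    then show ?thesis using assms by (simp add: pareto_log_le_iff max_def)
  qed
qed

text \<open>Almost surely every observation exceeds \<delta>. Then the truncation in
  \<open>pareto_log\<close> is inactive, both order statistics are positive, and \<delta> cancels in
  the difference of their logarithms.\<close>

lemma Qstar_eq_spacing:
  assumes "\<alpha> > 0" "\<delta> > 0" "s \<ge> 2" "k \<ge> 1" "n = k * (s + 1) - 1"
    and iid: "iid_sample M n (pareto_cdf \<alpha> \<delta>) X"
  defines "Y \<equiv> \<lambda>i \<omega>. pareto_log \<alpha> \<delta> (X i \<omega>)"
  shows "AE \<omega> in M. Qstar k s X \<omega>
    = (order_stat (k * s) n Y \<omega> - order_stat k n Y \<omega>) / (\<alpha> * ln (real s))"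
proof -
  interpret prob_space M using iid by (simp add: iid_sample_def)
  have n: "(s + 1) * k - 1 = n" using assms by (simp add: mult.commute)
  have ranks: "1 \<le> k" "k \<le> n" "1 \<le> k * s" "k * s \<le> n"
  proof -
    have "1 * 1 \<le> k * s" using assms by (intro mult_le_mono) auto
    moreover have "n = k * s + k - 1" using assms by (simp add: algebra_simps)
    ultimately show "1 \<le> k" "k \<le> n" "1 \<le> k * s" "k * s \<le> n" using \<open>k \<ge> 1\<close> by linarith+
  qed
  have "AE \<omega> in M. \<forall>i\<in>{..<n}. \<delta> < X i \<omega>"
  proof (rule AE_finite_allI)
    fix i assume "i \<in> {..<n}"
    then have i: "i < n" by simp
    have "prob {\<omega> \<in> space M. X i \<omega> \<le> \<delta>} = 0"
      using iid_sample_cdf[OF iid i] by (simp add: pareto_cdf_def)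
    then have "AE \<omega> in M. \<not> X i \<omega> \<le> \<delta>"
      using iid_sample_measurable[OF iid i] by (subst (asm) prob_Collect_eq_0) auto
    then show "AE \<omega> in M. \<delta> < X i \<omega>" by (simp add: not_le)
  qed simp
  then show ?thesis
  proof eventually_elim
    case (elim \<omega>)
    have gt: "\<delta> < order_stat m n X \<omega>" if m: "1 \<le> m" "m \<le> n" for m
    proof -
      have empty: "{i \<in> {..<n}. X i \<omega> \<le> \<delta>} = {}" using elim by force
      have "order_stat m n X \<omega> \<le> \<delta> \<longleftrightarrow> m \<le> card {i \<in> {..<n}. X i \<omega> \<le> \<delta>}"
        unfolding order_stat_eq_ostat using m by (intro ostat_le_iff) auto
      then show ?thesis using m unfolding empty by simp
    qed
    have Y: "order_stat m n Y \<omega> = pareto_log \<alpha> \<delta> (order_stat m n X \<omega>)" if "1 \<le> m" "m \<le> n" for m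
      unfolding order_stat_eq_ostat Y_def using assms(1,2) that
      by (intro ostat_mono_image mono_pareto_log) auto
    have Y': "order_stat m n Y \<omega> = \<alpha> * ln (order_stat m n X \<omega>) - \<alpha> * ln \<delta>" if "1 \<le> m" "m \<le> n" for m
      using gt[OF that] assms(2) by (simp add: Y[OF that] pareto_log_def max_def ln_div algebra_simps)
    have pos: "0 < order_stat m n X \<omega>" if "1 \<le> m" "m \<le> n" for m
      using gt[OF that] assms(2) by simp
    have ratio: "ln (order_stat (k * s) n X \<omega> / order_stat k n X \<omega>) = ln (order_stat (k * s) n X \<omega>) - ln (order_stat k n X \<omega>)"
      using pos[of "k * s"] pos[of k] ranks by (simp add: ln_div)
    have "order_stat (k * s) n Y \<omega> - order_stat k n Y \<omega>
        = \<alpha> * ln (order_stat (k * s) n X \<omega> / order_stat k n X \<omega>)"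
      using Y'[of "k * s"] Y'[of k] ranks by (simp add: ratio right_diff_distrib)
    then show ?case
      using assms(1) unfolding Qstar_def n by simp
  qed
qed

lemma prob_Qstar_le:
  assumes "\<alpha> > 0" "\<delta> > 0" "s \<ge> 2" "k \<ge> 1"
    and iid: "iid_sample M (k * (s + 1) - 1) (pareto_cdf \<alpha> \<delta>) X"
  shows "measure M {\<omega> \<in> space M. Qstar k s X \<omega> \<le> x}
      = spacing_cdf ((s - 1) * k) k (\<alpha> * ln (real s) * x)"
    and "Qstar k s X \<in> borel_measurable M"
proof -
  interpret prob_space M using iid by (simp add: iid_sample_def)
  define n where "n = k * (s + 1) - 1"
  define Y where "Y = (\<lambda>i \<omega>. pareto_log \<alpha> \<delta> (X i \<omega>))"
  have n: "(s + 1) * k - 1 = n" by (simp add: n_def mult.commute)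
  have "1 * (s - 1) \<le> k * (s - 1)" "k * 2 \<le> k * s" using assms by (intro mult_le_mono; simp)+
  then have ranks: "1 \<le> k" "k < k * s" "k * s \<le> n" "k \<le> n"
    and a: "k * s - k = (s - 1) * k" "n - k = (s - 1) * k + k - 1"
    using assms by (auto simp: n_def algebra_simps diff_mult_distrib)
  note iid' = iid[folded n_def]
  have iidY: "iid_sample M n (\<lambda>x. max 0 (1 - exp (- x))) Y"
    unfolding Y_def by (rule iid_sample_pareto_log[OF assms(1,2) iid'])
  show meas [measurable]: "Qstar k s X \<in> borel_measurable M"
    unfolding Qstar_def[abs_def] n
    using borel_measurable_order_stat[OF iid', of "k * s"] borel_measurable_order_stat[OF iid', of k] ranks
    by (intro borel_measurable_divide borel_measurable_ln borel_measurable_const) auto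
  have [measurable]: "order_stat (k * s) n Y \<in> borel_measurable M" "order_stat k n Y \<in> borel_measurable M"
    using ranks by (auto intro!: borel_measurable_order_stat[OF iidY])
  have c: "\<alpha> * ln (real s) > 0" using assms by simp
  have "AE \<omega> in M. Qstar k s X \<omega> \<le> x \<longleftrightarrow>
      order_stat (k * s) n Y \<omega> - order_stat k n Y \<omega> \<le> \<alpha> * ln (real s) * x"
    using Qstar_eq_spacing[OF assms(1-4) n_def iid'] unfolding Y_def[symmetric]
    by eventually_elim (use c in \<open>simp add: pos_divide_le_eq mult.commute\<close>)
  then have "prob {\<omega> \<in> space M. Qstar k s X \<omega> \<le> x}
      = prob {\<omega> \<in> space M. order_stat (k * s) n Y \<omega> - order_stat k n Y \<omega> \<le> \<alpha> * ln (real s) * x}"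
    by (intro prob_eq_AE) auto
  also have "\<dots> = 1 - binom_lower (n - k) (k * s - k) (max 0 (1 - exp (- (\<alpha> * ln (real s) * x))))"
    using ranks by (intro prob_exponential_spacing_le[OF iidY])
  finally show "prob {\<omega> \<in> space M. Qstar k s X \<omega> \<le> x} = spacing_cdf ((s - 1) * k) k (\<alpha> * ln (real s) * x)"
    by (simp add: spacing_cdf_def a)
qed

section \<open>Moments of a spacing\<close>

text \<open>Adjacent ranks: the spacing is exponential with rate \<open>k\<close>, the base of the
  moment recursion. The two densities disagree only at 0.\<close>

lemma spacing_density_eq_erlang: 
  assumes "k \<ge> 1"
  shows "AE x in lborel. spacing_density 1 k x = erlang_density 0 (real k) x"
  using AE_lborel_singleton[of "0::real"]
proof eventually_elim
  case (elim x)
  have "fact k = real k * fact (k - 1)" using assms by (simp add: fact_reduce)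
  then show ?case using elim
    by (auto simp: spacing_density_def spacing_const_def erlang_density_def field_simps simp flip: exp_of_nat_mult)
qed

lemma spacing_density_le_erlang:
  assumes "k \<ge> 1" "x \<noteq> 0"
  shows "spacing_density a k x \<le> spacing_const a k / real k * erlang_density 0 (real k) x"
proof (cases "x > 0")
  case True
  have "(1 - exp (- x)) ^ (a - 1) \<le> 1" using True by (intro power_le_one) auto
  then have "spacing_const a k * (1 - exp (- x)) ^ (a - 1) * exp (- x) ^ k \<le> spacing_const a k * 1 * exp (- x) ^ k"
    using spacing_const_pos[of a k] by (intro mult_right_mono mult_left_mono) auto
  then show ?thesis
    using True assms by (simp add: spacing_density_def erlang_density_def flip: exp_of_nat_mult)
qed (use assms in \<open>simp add: spacing_density_def erlang_density_def\<close>)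

lemma has_bochner_integral_erlang_0_moment:
  assumes "l > 0"
  shows "has_bochner_integral lborel (\<lambda>x. erlang_density 0 l x * x ^ i) (fact i / l ^ i)"
proof (rule has_bochner_integral_nn_integral)
  show "AE x in lborel. 0 \<le> erlang_density 0 l x * x ^ i"
    using assms by (auto simp: erlang_density_def)
  show "(\<integral>\<^sup>+x. ennreal (erlang_density 0 l x * x ^ i) \<partial>lborel) = ennreal (fact i / l ^ i)"
    using nn_integral_erlang_ith_moment[OF assms, of 0 i] by simp
qed (use assms in auto)

lemma integrable_spacing_moment:
  assumes "k \<ge> 1"
  shows "integrable lborel (\<lambda>x. spacing_density a k x * x ^ i)"
proof (rule Bochner_Integration.integrable_bound)
  show "integrable lborel (\<lambda>x. spacing_const a k / real k * (erlang_density 0 (real k) x * x ^ i))"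
    using has_bochner_integral_erlang_0_moment[of "real k" i] assms
    by (intro integrable_mult_right) (auto simp: has_bochner_integral_iff)
  show "AE x in lborel. norm (spacing_density a k x * x ^ i)
      \<le> norm (spacing_const a k / real k * (erlang_density 0 (real k) x * x ^ i))"
    using AE_lborel_singleton[of "0::real"]
  proof eventually_elim
    case (elim x)
    have "\<bar>spacing_density a k x * x ^ i\<bar> = spacing_density a k x * \<bar>x ^ i\<bar>"
      using spacing_density_nonneg[of a k x] by (simp add: abs_mult)
    also have "\<dots> \<le> spacing_const a k / real k * erlang_density 0 (real k) x * \<bar>x ^ i\<bar>"
      using spacing_density_le_erlang[OF assms elim] by (intro mult_right_mono) auto
    also have "\<dots> = \<bar>spacing_const a k / real k * (erlang_density 0 (real k) x * x ^ i)\<bar>"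
      using spacing_const_pos[of a k] by (simp add: abs_mult less_imp_le)
    finally show ?case by simp
  qed
qed measurable

lemma spacing_const_Suc: "a \<ge> 1 \<Longrightarrow> real a * spacing_const (Suc a) k = real (a + k) * spacing_const a k"
  by (cases a) (simp_all add: spacing_const_def del: of_nat_Suc)

text \<open>This is the differential equation for the density of a sum of the spacing for
  \<open>a\<close> and an independent exponential of rate a + k, that is, Renyi's representation of
  exponential spacings in differential form.\<close>

lemma DERIV_spacing_density_Suc:
  assumes "a \<ge> 1" "k \<ge> 1" "x > 0"
  shows "((spacing_density (Suc a) k) has_real_derivative
    real (a + k) * (spacing_density a k x - spacing_density (Suc a) k x)) (at x)"
proof -
  let ?C = "spacing_const (Suc a) k"
  let ?u = "1 - exp (- x)"
  have u: "?u ^ a = ?u ^ (a - 1) * ?u" using assms(1) by (metis One_nat_def Suc_pred less_le_trans mult.commute power_Suc zero_less_one)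
  have e: "exp (- x) ^ k = exp (- x) ^ (k - 1) * exp (- x)" using assms(2) by (metis One_nat_def Suc_pred less_le_trans mult.commute power_Suc zero_less_one)
  have "((\<lambda>x. ?C * (1 - exp (- x)) ^ a * exp (- x) ^ k) has_real_derivative
      ?C * (real a * ?u ^ (a - 1) * exp (- x) * exp (- x) ^ k - ?u ^ a * (real k * exp (- x) ^ (k - 1) * exp (- x)))) (at x)"
    by (auto intro!: derivative_eq_intros simp: algebra_simps)
  also have "?C * (real a * ?u ^ (a - 1) * exp (- x) * exp (- x) ^ k - ?u ^ a * (real k * exp (- x) ^ (k - 1) * exp (- x)))
      = (real a * ?C) * ?u ^ (a - 1) * exp (- x) ^ k - real (a + k) * (?C * ?u ^ a * exp (- x) ^ k)"
    unfolding u e by (simp add: algebra_simps)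
  also have "\<dots> = real (a + k) * (spacing_density a k x - spacing_density (Suc a) k x)"
    using assms unfolding spacing_const_Suc[OF assms(1)] by (simp add: spacing_density_def algebra_simps)
  finally have deriv: "((\<lambda>x. ?C * (1 - exp (- x)) ^ a * exp (- x) ^ k) has_real_derivative \<dots>) (at x)" .
  show ?thesis
  proof (rule has_field_derivative_transform_within_open[OF deriv])
    show "open {0::real<..}" "x \<in> {0<..}" using assms by auto
  qed (simp add: spacing_density_def)
qed

lemma isCont_spacing_density: "x > 0 \<Longrightarrow> isCont (spacing_density a k) x"
proof -
  assume "x > 0"
  have "isCont (\<lambda>x. spacing_const a k * (1 - exp (- x)) ^ (a - 1) * exp (- x) ^ k) x"
    by (intro continuous_intros)
  moreover have "\<forall>\<^sub>F y in nhds x. y > 0"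
    using \<open>x > 0\<close> eventually_nhds_in_open[of "{0<..}" x] by simp
  then have "\<forall>\<^sub>F y in nhds x. spacing_density a k y = spacing_const a k * (1 - exp (- y)) ^ (a - 1) * exp (- y) ^ k"
    by eventually_elim (simp add: spacing_density_def)
  ultimately show ?thesis
    using isCont_cong by fast
qed

text \<open>Integrate the derivative of \<open>F\<close> over the positive half-line. The boundary
  values vanish, at 0 through the powers of x and 1 - exp(-x), at infinity through exp(-kx), and the
  differential equation for the density turns the result into a recursion in
  \<open>a\<close>.\<close>

lemma spacing_moment_Suc:
  assumes a: "a \<ge> 1" and k: "k \<ge> 1"
  shows "(\<integral>x. spacing_density (Suc a) k x * x ^ Suc i \<partial>lborel)
    = (\<integral>x. spacing_density a k x * x ^ Suc i \<partial>lborel)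
      + real (Suc i) / real (a + k) * (\<integral>x. spacing_density (Suc a) k x * x ^ i \<partial>lborel)"
proof -
  let ?w = "spacing_density (Suc a) k" and ?w' = "spacing_density a k"
  define F where "F x = ?w x * x ^ Suc i" for x
  define f where "f x = real (a + k) * (?w' x * x ^ Suc i - ?w x * x ^ Suc i) + real (Suc i) * (?w x * x ^ i)" for x
  have int: "integrable lborel f"
    unfolding f_def using integrable_spacing_moment[OF k]
    by (intro Bochner_Integration.integrable_add integrable_mult_right Bochner_Integration.integrable_diff)
  have zero: "f x = 0" if "x \<le> 0" for x
    using that by (simp add: f_def spacing_density_def)
  have "(LBINT x=ereal 0..\<infinity>. f x) = 0 - 0"
  proof (rule interval_integral_FTC_integrable)
    show "(F has_vector_derivative f x) (at x)" if "ereal 0 < ereal x" for x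
    proof -
      have x: "x > 0" using that by simp
      have "(F has_real_derivative (real (a + k) * (?w' x - ?w x)) * x ^ Suc i + (real (Suc i) * x ^ i) * ?w x) (at x)"
        unfolding F_def using DERIV_pow[of "Suc i" x UNIV]
        by (intro DERIV_mult DERIV_spacing_density_Suc a k x) simp
      then show ?thesis
        unfolding has_real_derivative_iff_has_vector_derivative[symmetric] f_def by (simp add: algebra_simps)
    qed
    show "isCont f x" if "ereal 0 < ereal x" for x
      unfolding f_def using that by (intro continuous_intros isCont_spacing_density) auto
    show "set_integrable lborel (einterval (ereal 0) \<infinity>) f"
      using int unfolding set_integrable_def by (intro integrable_mult_indicator) auto
    show "((F \<circ> real_of_ereal) \<longlongrightarrow> 0) (at_right (ereal 0))"
    proof -
      have "((\<lambda>x. spacing_const (Suc a) k * (1 - exp (- x)) ^ a * exp (- x) ^ k * x ^ Suc i)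
          \<longlongrightarrow> spacing_const (Suc a) k * (1 - exp (- 0)) ^ a * exp (- 0) ^ k * 0 ^ Suc i) (at_right (0::real))"
        by (intro tendsto_intros)
      then have "(F \<longlongrightarrow> 0) (at_right 0)"
        unfolding power_0_Suc mult_zero_right
        by (rule Lim_transform_eventually)
           (auto simp: eventually_at_right_field F_def spacing_density_def intro!: exI[of _ 1])
      then show ?thesis
        by (simp add: comp_def ereal_tendsto_simps1 at_right_ereal filterlim_filtermap)
    qed
    show "((F \<circ> real_of_ereal) \<longlongrightarrow> 0) (at_left \<infinity>)"
    proof -
      have "((\<lambda>x. spacing_const (Suc a) k * (1 - exp (- x)) ^ a * (x ^ Suc i / exp (real k * x)))
          \<longlongrightarrow> spacing_const (Suc a) k * (1 - 0) ^ a * 0) (at_top :: real filter)"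
      proof (intro tendsto_intros)
        show "((\<lambda>x::real. exp (- x)) \<longlongrightarrow> 0) at_top" by real_asymp
        have "real k > 0" using k by simp
        then show "((\<lambda>x. x ^ Suc i / exp (real k * x)) \<longlongrightarrow> 0) at_top" by real_asymp
      qed
      then have "(F \<longlongrightarrow> 0) at_top"
        unfolding mult_zero_right
        by (rule Lim_transform_eventually)
           (auto simp: eventually_at_top_linorder F_def spacing_density_def exp_minus field_simps power_inverse
             intro!: exI[of _ 1] simp flip: exp_of_nat_mult)
      then show ?thesis
        by (simp add: comp_def ereal_tendsto_simps at_left_PInf filterlim_filtermap)
    qed
  qed simp
  moreover have "(LBINT x=ereal 0..\<infinity>. f x) = (\<integral>x. f x \<partial>lborel)"
    unfolding interval_lebesgue_integral_def set_lebesgue_integral_def using zero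
    by (auto simp: einterval_def indicator_def not_less intro!: Bochner_Integration.integral_cong)
  ultimately have "(\<integral>x. f x \<partial>lborel) = 0" by simp
  moreover have "(\<integral>x. f x \<partial>lborel) = real (a + k) * ((\<integral>x. ?w' x * x ^ Suc i \<partial>lborel) - (\<integral>x. ?w x * x ^ Suc i \<partial>lborel))
      + real (Suc i) * (\<integral>x. ?w x * x ^ i \<partial>lborel)"
    unfolding f_def using integrable_spacing_moment[OF k]
    by (subst Bochner_Integration.integral_add) (auto intro!: integrable_mult_right Bochner_Integration.integrable_diff simp del: power_Suc)
  ultimately show ?thesis
    using a by (simp add: field_simps del: power_Suc)
qed

lemma integral_spacing_density:
  assumes "a \<ge> 1" "k \<ge> 1"
  shows "(\<integral>x. spacing_density a k x \<partial>lborel) = 1"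
  using nn_integral_spacing_density(2)[OF assms, of 1] spacing_density_nonneg
  by (subst integral_eq_nn_integral) auto

lemma spacing_moment_1:
  assumes "k \<ge> 1" 
  shows "(\<integral>x. spacing_density 1 k x * x ^ i \<partial>lborel) = fact i / real k ^ i"
proof -
  have "(\<integral>x. spacing_density 1 k x * x ^ i \<partial>lborel) = (\<integral>x. erlang_density 0 (real k) x * x ^ i \<partial>lborel)"
    using spacing_density_eq_erlang[OF assms] by (intro integral_cong_AE) auto
  then show ?thesis
    using has_bochner_integral_erlang_0_moment[of "real k" i] assms by (simp add: has_bochner_integral_iff)
qed

lemma spacing_mean:
  assumes "a \<ge> 1" "k \<ge> 1"
  shows "(\<integral>x. spacing_density a k x * x \<partial>lborel) = (\<Sum>r=k..<a+k. 1 / real r)"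
  using assms(1)
proof (induction a rule: dec_induct)
  case base
  show ?case using spacing_moment_1[OF assms(2), of 1] by simp
next
  case (step a)
  then show ?case
    using spacing_moment_Suc[OF step(1) assms(2), of 0] integral_spacing_density[of "Suc a" k] assms by simp
qed

text \<open>The two summands are the variance and the squared mean. Passing from \<open>a\<close> to
  \<open>Suc a\<close> adds 1/(a + k) to the mean and its square to the variance.\<close>

lemma spacing_second_moment:
  assumes "a \<ge> 1" "k \<ge> 1"
  shows "(\<integral>x. spacing_density a k x * x\<^sup>2 \<partial>lborel)
    = (\<Sum>r=k..<a+k. 1 / (real r)\<^sup>2) + (\<Sum>r=k..<a+k. 1 / real r)\<^sup>2"
  using assms(1)
proof (induction a rule: dec_induct)
  case base
  show ?case using spacing_moment_1[OF assms(2), of 2] by (simp add: power_divide)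
next
  case (step a)
  define N \<mu> V where "N = real (a + k)" and "\<mu> = (\<Sum>r=k..<a+k. 1 / real r)"
    and "V = (\<Sum>r=k..<a+k. 1 / (real r)\<^sup>2)"
  have "N > 0" using step by (simp add: N_def)
  have "(\<integral>x. spacing_density (Suc a) k x * x\<^sup>2 \<partial>lborel) = (V + \<mu>\<^sup>2) + 2 / N * (\<mu> + 1 / N)"
    using spacing_moment_Suc[OF step(1) assms(2), of 1] spacing_mean[of "Suc a" k] step assms
    by (simp add: numeral_2_eq_2[symmetric] N_def \<mu>_def V_def)
  also have "\<dots> = (V + 1 / N\<^sup>2) + (\<mu> + 1 / N)\<^sup>2"
    using \<open>N > 0\<close> by (simp add: power2_sum power_divide) (simp add: power2_eq_square field_simps)
  finally show ?case by (simp add: N_def \<mu>_def V_def)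
qed

text \<open>In the variable p = exp(-x) the density is a multiple of (1-p)^(a-1) p^k, which
  increases up to its mode k/(a+k-1). The hypothesis on exp(-x) places \<open>x\<close> beyond that
  mode.\<close>

lemma spacing_density_antimono:
  assumes "k \<ge> 1" "0 < x" "x \<le> y" and le: "real (a + k - 1) * exp (- x) \<le> real k" "a \<ge> 1"
  shows "spacing_density a k y \<le> spacing_density a k x"
proof -
  define h where "h p = (1 - p) ^ (a - 1) * p ^ k" for p :: real
  have "h (exp (- y)) \<le> h (exp (- x))"
  proof (rule DERIV_nonneg_imp_nondecreasing[where f = h])
    show "exp (- y) \<le> exp (- x)" using assms by simp
    fix p assume p: "exp (- y) \<le> p" "p \<le> exp (- x)"
    have "exp (- x) < 1" using assms by simp
    then have p01: "0 < p" "p < 1"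
      using p exp_gt_zero[of "- y"] by linarith+
    have le_p: "real (a + k - 1) * p \<le> real k"
      using p(2) le(1) by (meson mult_left_mono of_nat_0_le_iff order_trans)
    have "(h has_real_derivative - (real (a - 1) * (1 - p) ^ (a - 1 - 1)) * p ^ k + (1 - p) ^ (a - 1) * (real k * p ^ (k - 1))) (at p)"
      unfolding h_def by (auto intro!: derivative_eq_intros simp: algebra_simps)
    moreover have "0 \<le> - (real (a - 1) * (1 - p) ^ (a - 1 - 1)) * p ^ k + (1 - p) ^ (a - 1) * (real k * p ^ (k - 1))"
    proof (cases "a = 1")
      case False
      have pk: "p ^ k = p * p ^ (k - 1)" using \<open>k \<ge> 1\<close> by (simp add: power_eq_if)
      have pa: "(1 - p) ^ (a - 1) = (1 - p) * (1 - p) ^ (a - 1 - 1)" using False \<open>a \<ge> 1\<close> by (simp add: power_eq_if)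
      have "- (real (a - 1) * (1 - p) ^ (a - 1 - 1)) * p ^ k + (1 - p) ^ (a - 1) * (real k * p ^ (k - 1))
          = ((1 - p) * real k - real (a - 1) * p) * ((1 - p) ^ (a - 1 - 1) * p ^ (k - 1))"
        unfolding pk pa by (simp add: algebra_simps)
      moreover have "(1 - p) * real k - real (a - 1) * p = real k - real (a + k - 1) * p"
        using \<open>a \<ge> 1\<close> by (simp add: of_nat_diff algebra_simps)
      ultimately show ?thesis using le_p p01 by simp
    qed (use p01 in simp)
    ultimately show "\<exists>z. (h has_real_derivative z) (at p) \<and> 0 \<le> z" by blast
  qed
  then show ?thesis
    using assms spacing_const_pos[of a k] by (simp add: spacing_density_def h_def mult.assoc)
qed

text \<open>A factor exp(-x) raises \<open>k\<close> by one. As both densities have integral 1, the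
  ratio of constants k/(a+k) is the mean of exp(-W).\<close>

lemma exp_mult_spacing_density:
  assumes "a \<ge> 1" "k \<ge> 1"
  shows "spacing_density a k x * exp (- x) = real k / real (a + k) * spacing_density a (Suc k) x"
proof -
  have "spacing_const a k = real k / real (a + k) * spacing_const a (Suc k)"
  proof -
    have "fact (a + k) = real (a + k) * fact (a + k - 1)" "fact k = real k * fact (k - 1)"
      using assms by (simp_all add: fact_reduce)
    then show ?thesis using assms by (simp add: spacing_const_def)
  qed
  then show ?thesis by (simp add: spacing_density_def)
qed

text \<open>Under this density exp(-x) is Beta distributed with parameters k and a and has mean 1/c,
  so the integral is c^2 times a beta variance. Expanding the square leaves three densities, each of
  integral 1.\<close>

lemma spacing_exp_moment:
  assumes "a \<ge> 1" "k \<ge> 1" "real (a + k) = c * real k"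
  shows "integrable lborel (\<lambda>x. spacing_density a k x * (c * exp (- x) - 1)\<^sup>2)"
    and "(\<integral>x. spacing_density a k x * (c * exp (- x) - 1)\<^sup>2 \<partial>lborel) = (c - 1) / (c * real k + 1)"
proof -
  have pos: "c * real k > 0" unfolding assms(3)[symmetric] using assms(1) by simp
  then have "c > 0" using assms(2) by (simp add: zero_less_mult_iff)
  \<comment> \<open>The mean of exp(-x) once \<open>k\<close> has been raised by one.\<close>
  let ?q = "(real k + 1) / (c * real k + 1)"
  have 1: "spacing_density a k x * exp (- x) = 1 / c * spacing_density a (Suc k) x" for x
    using exp_mult_spacing_density[OF assms(1,2), of x] assms by simp
  have 2: "spacing_density a (Suc k) x * exp (- x) = ?q * spacing_density a (Suc (Suc k)) x" for x
    using exp_mult_spacing_density[of a "Suc k" x] assms by (simp add: add.commute)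
  have eq: "spacing_density a k x * (c * exp (- x) - 1)\<^sup>2
      = c * ?q * spacing_density a (Suc (Suc k)) x - 2 * spacing_density a (Suc k) x + spacing_density a k x" for x
  proof -
    have "spacing_density a k x * (c * exp (- x) - 1)\<^sup>2
      = c\<^sup>2 * (spacing_density a k x * exp (- x)) * exp (- x) - 2 * c * (spacing_density a k x * exp (- x)) + spacing_density a k x"
      by (simp add: power2_eq_square algebra_simps)
    also have "\<dots> = c * (spacing_density a (Suc k) x * exp (- x)) - 2 * spacing_density a (Suc k) x + spacing_density a k x"
      unfolding 1 using \<open>c > 0\<close> by (simp add: power2_eq_square)
    finally show ?thesis unfolding 2 by simp
  qed
  have int: "integrable lborel (spacing_density a j)" if "j \<ge> 1" for j
    using integrable_spacing_moment[OF that, of a 0] by simp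
  show "integrable lborel (\<lambda>x. spacing_density a k x * (c * exp (- x) - 1)\<^sup>2)"
    unfolding eq using assms
    by (intro Bochner_Integration.integrable_add Bochner_Integration.integrable_diff integrable_mult_right int) auto
  have "(\<integral>x. spacing_density a k x * (c * exp (- x) - 1)\<^sup>2 \<partial>lborel) = c * ?q - 2 + 1"
    unfolding eq using assms
    by (simp add: Bochner_Integration.integral_add Bochner_Integration.integral_diff int integral_spacing_density)
  also have "\<dots> = (c - 1) / (c * real k + 1)"
    using pos by (simp add: field_simps add_nonneg_eq_0_iff)
  finally show "(\<integral>x. spacing_density a k x * (c * exp (- x) - 1)\<^sup>2 \<partial>lborel) = (c - 1) / (c * real k + 1)" .
qed

lemma spacing_central_moment:
  assumes "a \<ge> 1" "k \<ge> 1"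
  shows "integrable lborel (\<lambda>x. spacing_density a k x * (x - z)\<^sup>2)"
    and "(\<integral>x. spacing_density a k x * (x - z)\<^sup>2 \<partial>lborel)
      = (\<Sum>r=k..<a+k. 1 / (real r)\<^sup>2) + ((\<Sum>r=k..<a+k. 1 / real r) - z)\<^sup>2"
proof -
  have eq: "spacing_density a k x * (x - z)\<^sup>2
      = spacing_density a k x * x\<^sup>2 - 2 * z * (spacing_density a k x * x) + z\<^sup>2 * spacing_density a k x" for x
    by (simp add: power2_eq_square algebra_simps)
  have int: "integrable lborel (\<lambda>x. spacing_density a k x * x\<^sup>2)" "integrable lborel (\<lambda>x. spacing_density a k x * x)"
     "integrable lborel (spacing_density a k)"
    using integrable_spacing_moment[OF assms(2), of a 2] integrable_spacing_moment[OF assms(2), of a 1]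
      integrable_spacing_moment[OF assms(2), of a 0] by simp_all
  show "integrable lborel (\<lambda>x. spacing_density a k x * (x - z)\<^sup>2)"
    unfolding eq
    by (intro Bochner_Integration.integrable_add Bochner_Integration.integrable_diff integrable_mult_right int)
  show "(\<integral>x. spacing_density a k x * (x - z)\<^sup>2 \<partial>lborel)
      = (\<Sum>r=k..<a+k. 1 / (real r)\<^sup>2) + ((\<Sum>r=k..<a+k. 1 / real r) - z)\<^sup>2"
    unfolding eq using int
    by (simp add: Bochner_Integration.integral_add Bochner_Integration.integral_diff
        integral_spacing_density[OF assms] spacing_mean[OF assms] spacing_second_moment[OF assms])
       (simp add: power2_eq_square algebra_simps)
qed

section \<open>The tail bound around the logarithm\<close>

text \<open>The second bound uses the midpoint estimate 2/(2r+1) for the integral of 1/x over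
  [r, r+1]. What remains is 1/(r(2r+1)), and 2/3 is the least factor for which a multiple of
  1/(r(r+1)) dominates it for all r \<ge> 1, with equality at r = 1. The right side is chosen to
  telescope.\<close>

lemma harmonic_ln_bounds:
  assumes "r \<ge> 1"
  shows "ln (real (Suc r)) - ln (real r) \<le> 1 / real r"
    and "1 / real r - (ln (real (Suc r)) - ln (real r)) \<le> 2 / 3 * (1 / real r - 1 / real (Suc r))"
proof -
  have "1 + 1 / real r = real (Suc r) / real r"
    using assms by (simp add: field_simps)
  then have "ln (real (Suc r)) - ln (real r) = ln (1 + 1 / real r)"
    using assms by (simp add: ln_div)
  then show "ln (real (Suc r)) - ln (real r) \<le> 1 / real r"
    by (simp add: ln_add_one_self_le_self)
  have "2 / (2 * real r + 1) \<le> ln (real (Suc r)) - ln (real r)"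
    using ln_inverse_approx_ge[of "real r" "real (Suc r)"] assms by (simp add: algebra_simps)
  moreover have "1 / real r - 2 / (2 * real r + 1) \<le> 2 / 3 * (1 / real r - 1 / real (Suc r))"
    using assms by (simp add: divide_simps)
  ultimately show "1 / real r - (ln (real (Suc r)) - ln (real r)) \<le> 2 / 3 * (1 / real r - 1 / real (Suc r))"
    by linarith
qed

text \<open>Termwise comparison with two telescoping sums, \<open>A\<close> and 1/k^2 - 1/m^2, the
  latter being at least A^2. Measuring everything by \<open>A\<close> lets the excess of
  \<open>V\<close> over \<open>A\<close> absorb the squared bias.\<close>

lemma
  assumes "1 \<le> k" "k \<le> m"
  defines "\<mu> \<equiv> \<Sum>r=k..<m. 1 / real r" and "V \<equiv> \<Sum>r=k..<m. 1 / (real r)\<^sup>2"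
    and "A \<equiv> 1 / real k - 1 / real m"
  shows harmonic_minus_ln_nonneg: "0 \<le> \<mu> - (ln (real m) - ln (real k))"
    and harmonic_minus_ln_le: "\<mu> - (ln (real m) - ln (real k)) \<le> 2 / 3 * A"
    and sum_inverse_squares_ge: "A + A\<^sup>2 / 2 \<le> V"
proof -
  have tel: "(\<Sum>r=k..<m. f (Suc r) - f r) = f m - f k" for f :: "nat \<Rightarrow> real"
    using assms(2) by (rule sum_Suc_diff')
  have A: "A = (\<Sum>r=k..<m. 1 / real r - 1 / real (Suc r))"
    using tel[of "\<lambda>r. - 1 / real r"] by (simp add: A_def)
  have b: "\<mu> - (ln (real m) - ln (real k)) = (\<Sum>r=k..<m. 1 / real r - (ln (real (Suc r)) - ln (real r)))"
    unfolding \<mu>_def tel[of "\<lambda>r. ln (real r)", symmetric] by (simp only: sum_subtractf)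
  show "0 \<le> \<mu> - (ln (real m) - ln (real k))"
    unfolding b using harmonic_ln_bounds(1) assms(1) by (intro sum_nonneg) simp
  show "\<mu> - (ln (real m) - ln (real k)) \<le> 2 / 3 * A"
    unfolding b A sum_distrib_left using harmonic_ln_bounds(2) assms(1) by (intro sum_mono) simp
  have "0 \<le> A" using assms by (simp add: A_def frac_le)
  have "A\<^sup>2 \<le> A * (1 / real k + 1 / real m)"
    unfolding power2_eq_square using \<open>0 \<le> A\<close> by (intro mult_left_mono) (simp_all add: A_def)
  also have "\<dots> = 1 / (real k)\<^sup>2 - 1 / (real m)\<^sup>2"
    by (simp add: A_def power2_eq_square algebra_simps)
  also have "\<dots> = (\<Sum>r=k..<m. 1 / (real r)\<^sup>2 - 1 / (real (Suc r))\<^sup>2)"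
    using tel[of "\<lambda>r. - 1 / (real r)\<^sup>2"] by simp
  finally have "A + A\<^sup>2 / 2 \<le> (\<Sum>r=k..<m. (1 / real r - 1 / real (Suc r)) + (1 / (real r)\<^sup>2 - 1 / (real (Suc r))\<^sup>2) / 2)"
    unfolding A by (simp add: sum.distrib sum_divide_distrib[symmetric])
  also have "\<dots> \<le> V"
    unfolding V_def
  proof (rule sum_mono)
    fix r assume "r \<in> {k..<m}"
    then have r: "real r > 0" using assms(1) by simp
    \<comment> \<open>The slack in each term is half the square of 1/r - 1/(r+1).\<close>
    have "1 / (real r)\<^sup>2 - ((1 / real r - 1 / (real r + 1)) + (1 / (real r)\<^sup>2 - 1 / (real r + 1)\<^sup>2) / 2)
        = 1 / (2 * (real r)\<^sup>2 * (real r + 1)\<^sup>2)"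
      using r by (simp add: divide_simps) (simp add: power2_eq_square algebra_simps)
    moreover have "\<dots> \<ge> 0" by simp
    ultimately show "(1 / real r - 1 / real (Suc r)) + (1 / (real r)\<^sup>2 - 1 / (real (Suc r))\<^sup>2) / 2 \<le> 1 / (real r)\<^sup>2"
      unfolding of_nat_Suc add.commute[of 1] by linarith
  qed
  finally show "A + A\<^sup>2 / 2 \<le> V" .
qed

text \<open>A pointwise bound on t^2 times the indicator is integrated. To the right of
  \<open>L\<close> the term 4/9 (x-L)^2, corrected by \<open>G\<close>, pays for the tail. To the
  left it is topped up by 5/9 of the exponential square. The multiple of \<open>G\<close> costs
  nothing, since \<open>G\<close> has integral 0.\<close>

lemma spacing_tail_bound:
  assumes a: "a \<ge> 1" and k: "k \<ge> 1" and s: "a + k = s * k" and t: "t > 0"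
  defines "L \<equiv> ln (real s)"
  shows "t\<^sup>2 * (\<integral>x. spacing_density a k x * indicator {x. t < \<bar>x - L\<bar>} x \<partial>lborel)
    \<le> (\<Sum>r=k..<a+k. 1 / (real r)\<^sup>2)"
proof -
  let ?w = "spacing_density a k"
  define \<mu> V A where "\<mu> = (\<Sum>r=k..<a+k. 1 / real r)" and "V = (\<Sum>r=k..<a+k. 1 / (real r)\<^sup>2)"
    and "A = 1 / real k - 1 / real (a + k)"
  have s2: "s \<ge> 2"
  proof (rule ccontr)
    assume "\<not> s \<ge> 2"
    then have "s * k \<le> 1 * k" by (intro mult_le_mono) auto
    then show False using a s by linarith
  qed
  then have L: "exp L = real s" "exp (- L) = 1 / real s" "L > 0"
    by (simp_all add: L_def exp_minus inverse_eq_divide)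
  have ak: "real (a + k) = real s * real k" unfolding s by simp

  \<comment> \<open>Gauss' inequality: \<open>G\<close> has integral \<open>0\<close>, and on the support of \<open>G\<close> the integrand
    \<open>4/9 y\<^sup>2 - t\<^sup>2 1[y > t]\<close>, with \<open>y = x - L\<close>, changes sign where the decreasing density
    crosses the level \<open>w (L + t)\<close>.\<close>
  define G where "G x = 4 / 9 * ((x - L)\<^sup>2 * indicator {L..L + 3 / 2 * t} x) - t\<^sup>2 * indicator {L + t..L + 3 / 2 * t} x" for x
  have G1: "has_bochner_integral lborel (\<lambda>x. (x - L)\<^sup>2 * indicator {L..L + 3 / 2 * t} x)
      ((L + 3 / 2 * t - L) ^ 3 / 3 - (L - L) ^ 3 / 3)"
    using t by (intro has_bochner_integral_FTC_Icc_real)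
      (auto intro!: derivative_eq_intros continuous_intros simp: power2_eq_square)
  have G2: "has_bochner_integral lborel (indicator {L + t..L + 3 / 2 * t} :: real \<Rightarrow> real) (t / 2)"
    using has_bochner_integral_real_indicator[of "{L + t..L + 3 / 2 * t}" lborel] t by (simp add: field_simps)
  have "has_bochner_integral lborel G
      (4 / 9 * ((L + 3 / 2 * t - L) ^ 3 / 3 - (L - L) ^ 3 / 3) - t\<^sup>2 * (t / 2))"
    unfolding G_def by (intro has_bochner_integral_diff has_bochner_integral_mult_right G1 G2)
  \<comment> \<open>Both parts of \<open>G\<close> contribute t^3/2. The endpoint 3/2 t is where 4/9
    y^2 reaches t^2, and 4/9 is the constant for which the two contributions balance.\<close>
  then have G: "integrable lborel G" "(\<integral>x. G x \<partial>lborel) = 0"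
    by (simp_all add: has_bochner_integral_iff power_mult_distrib power2_eq_square power3_eq_cube)

  \<comment> \<open>exp(-L) = 1/s = k/(a+k) lies below the mode k/(a+k-1), so the density decreases
    on the whole half-line from \<open>L\<close>.\<close>
  have anti: "?w y \<le> ?w x" if "L \<le> x" "x \<le> y" for x y
  proof (rule spacing_density_antimono[OF k _ that(2) _ a])
    show "0 < x" using that L by linarith
    have "real (a + k - 1) * exp (- x) \<le> real (a + k) * exp (- L)"
      using that by (intro mult_mono) auto
    also have "\<dots> = real k" unfolding ak L(2) using s2 by simp
    finally show "real (a + k - 1) * exp (- x) \<le> real k" .
  qed

  have pointwise: "t\<^sup>2 * (?w x * indicator {x. t < \<bar>x - L\<bar>} x)
      \<le> 4 / 9 * (?w x * (x - L)\<^sup>2) + 5 / 9 * (?w x * (real s * exp (- x) - 1)\<^sup>2) - ?w (L + t) * G x" for x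
  proof -
    have w: "?w x \<ge> 0" "?w (L + t) \<ge> 0" by (rule spacing_density_nonneg)+
    define y where "y = x - L"
    have x: "x = L + y" by (simp add: y_def)
    have E: "0 \<le> 5 / 9 * (?w x * (real s * exp (- x) - 1)\<^sup>2)" using w by simp
    consider "y < - t" | "- t \<le> y" "y < 0" | "0 \<le> y" "y < t" | "y = t" | "t < y" "y \<le> 3 / 2 * t" | "3 / 2 * t < y"
      by linarith
    then show ?thesis
    proof cases
      case 1
      \<comment> \<open>Here s exp(-x) = exp(-y), so this is 1 + z \<le> exp z at z = -y.\<close>
      have "- y \<le> real s * exp (- x) - 1"
        using exp_ge_add_one_self[of "- y"] s2 by (simp add: x exp_add exp_diff L exp_minus field_simps)
      then have "(- y)\<^sup>2 \<le> (real s * exp (- x) - 1)\<^sup>2"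
        using 1 t by (intro power_mono) auto
      moreover have "t\<^sup>2 \<le> (- y)\<^sup>2" using 1 t by (intro power_mono) auto
      ultimately have "t\<^sup>2 \<le> 4 / 9 * y\<^sup>2 + 5 / 9 * (real s * exp (- x) - 1)\<^sup>2" by simp
      from mult_left_mono[OF this w(1)] show ?thesis
        using 1 t by (simp add: G_def indicator_def x algebra_simps)
    next
      case 2
      then show ?thesis using w t E by (simp add: G_def indicator_def x)
    next
      case 3
      then have "0 \<le> 4 / 9 * y\<^sup>2 * (?w x - ?w (L + t))"
        using anti[of x "L + t"] by (simp add: x)
      then show ?thesis using 3 t E by (simp add: G_def indicator_def x algebra_simps)
    next
      case 4
      \<comment> \<open>The closed interval in \<open>G\<close> contains y = t while the strict
        event does not; the discrepancy is in favour of the bound.\<close>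
      then show ?thesis using w t E by (simp add: G_def indicator_def x algebra_simps)
    next
      case 5
      have "y\<^sup>2 \<le> (3 / 2 * t)\<^sup>2" using 5 t by (intro power_mono) auto
      then have "4 / 9 * y\<^sup>2 - t\<^sup>2 \<le> 0" by (simp add: power_mult_distrib power_divide)
      moreover have "?w x - ?w (L + t) \<le> 0" using anti[of "L + t" x] 5 t by (simp add: x)
      \<comment> \<open>Beyond t both the quadratic and the density are below their reference
        values, so their product of differences is nonnegative.\<close>
      ultimately have "0 \<le> (4 / 9 * y\<^sup>2 - t\<^sup>2) * (?w x - ?w (L + t))"
        by (rule mult_nonpos_nonpos)
      then show ?thesis using 5 t E
        by (simp add: G_def indicator_def x algebra_simps add_divide_distrib diff_divide_distrib)
    next
      case 6
      have "(3 / 2 * t)\<^sup>2 \<le> y\<^sup>2" using 6 t by (intro power_mono) auto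
      then have "t\<^sup>2 \<le> 4 / 9 * y\<^sup>2" by (simp add: power_mult_distrib power_divide)
      from mult_left_mono[OF this w(1)] show ?thesis
        using 6 t E by (simp add: G_def indicator_def x algebra_simps)
    qed
  qed

  have int_w: "integrable lborel ?w"
    using integrable_spacing_moment[OF k, of a 0] by simp
  note int1 = spacing_central_moment[OF a k, of L] and int2 = spacing_exp_moment[OF a k ak]
  have "t\<^sup>2 * (\<integral>x. ?w x * indicator {x. t < \<bar>x - L\<bar>} x \<partial>lborel)
      = (\<integral>x. t\<^sup>2 * (?w x * indicator {x. t < \<bar>x - L\<bar>} x) \<partial>lborel)"
    by simp
  also have "\<dots> \<le> (\<integral>x. 4 / 9 * (?w x * (x - L)\<^sup>2) + 5 / 9 * (?w x * (real s * exp (- x) - 1)\<^sup>2) - ?w (L + t) * G x \<partial>lborel)"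
    using int1(1) int2(1) G(1) pointwise
    by (intro integral_mono integrable_mult_right integrable_real_mult_indicator int_w
        Bochner_Integration.integrable_add Bochner_Integration.integrable_diff) auto
  also have "\<dots> = 4 / 9 * (V + (\<mu> - L)\<^sup>2) + 5 / 9 * ((real s - 1) / (real s * real k + 1))"
    using int1 int2 G by (simp add: Bochner_Integration.integral_add Bochner_Integration.integral_diff V_def \<mu>_def)
  also have "\<dots> \<le> V"
  proof -
    have ka: "1 \<le> k" "k \<le> a + k" using k by auto
    have "ln (real (a + k)) - ln (real k) = L"
      unfolding ak L_def using k s2 by (simp add: ln_mult)
    then have b: "0 \<le> \<mu> - L" "\<mu> - L \<le> 2 / 3 * A" and VA: "A + A\<^sup>2 / 2 \<le> V"
      using harmonic_minus_ln_nonneg[OF ka] harmonic_minus_ln_le[OF ka] sum_inverse_squares_ge[OF ka]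
      by (simp_all add: \<mu>_def V_def A_def)
    have "(\<mu> - L)\<^sup>2 \<le> (2 / 3 * A)\<^sup>2" using b by (intro power_mono)
    then have b2: "(\<mu> - L)\<^sup>2 \<le> 4 / 9 * A\<^sup>2" by (simp add: power_mult_distrib power_divide)
    have "(real s - 1) / (real s * real k + 1) \<le> (real s - 1) / (real s * real k)"
      using s2 k by (intro frac_le) auto
    also have "\<dots> = A"
      unfolding A_def ak using s2 k by (simp add: field_simps)
    finally have "(real s - 1) / (real s * real k + 1) \<le> A" .
    moreover have "0 \<le> A\<^sup>2" by simp
    \<comment> \<open>After division by 5/9 the claim is D + 4/5 B \<le> V, and 4/5 * 4/9 = 16/45
      \<le> 1/2. The squares are abstracted to keep the arithmetic linear.\<close>
    moreover have lin: "4 / 9 * (V + B) + 5 / 9 * D \<le> V"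
      if "D \<le> A" "0 \<le> A2" "A + A2 / 2 \<le> V" "B \<le> 4 / 9 * A2" for A2 B D
      using that by (simp add: field_simps)
    ultimately show ?thesis using VA b2 by (intro lin)
  qed
  finally show ?thesis by (simp add: V_def)
qed

section \<open>The estimator\<close>

lemma gen_harm_diff:
  assumes "1 \<le> k" "k \<le> m"
  shows "gen_harm (m - 1) j - gen_harm (k - 1) j = (\<Sum>r=k..<m. 1 / real r ^ j)"
proof -
  have "{1..m - 1} = {1..k - 1} \<union> {k..<m}" "{1..k - 1} \<inter> {k..<m} = {}"
    using assms by auto
  then show ?thesis by (simp add: gen_harm_def sum.union_disjoint)
qed

lemma Qstar_density_eq:
  assumes "s \<ge> 2" "k \<ge> 1" "\<alpha> > 0"
  shows "Qstar_density \<alpha> k s x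
    = \<alpha> * ln (real s) * spacing_density ((s - 1) * k) k (\<alpha> * ln (real s) * x)"
proof -
  define c where "c = \<alpha> * ln (real s)"
  have "c > 0" using assms by (simp add: c_def)
  then have pos: "0 < c * x \<longleftrightarrow> 0 < x" by (simp add: zero_less_mult_iff)
  have a: "(s - 1) * k + k = k * s" using assms(1) by (cases s) simp_all
  have const: "spacing_const ((s - 1) * k) k = fact (k * s - 1) / (fact ((s - 1) * k - 1) * fact (k - 1))"
    unfolding spacing_const_def a ..
  have pow: "real s powr (- \<alpha> * x) = exp (- (c * x))"
    "real s powr (- \<alpha> * real k * x) = exp (- (c * x)) ^ k"
    using assms by (simp_all add: powr_def c_def mult_ac flip: exp_of_nat_mult)
  show ?thesis
    unfolding Qstar_density_def spacing_density_def const pow c_def[symmetric] pos by simp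
qed

lemma eq_in_distr_spacing:
  assumes "prob_space M" "prob_space N" and ak: "a \<ge> 1" "k \<ge> 1" "c > 0"
    and "X \<in> borel_measurable M" "Y \<in> borel_measurable N"
    and "\<And>x. measure M {\<omega> \<in> space M. X \<omega> \<le> x} = spacing_cdf a k (c * x)"
    and "\<And>x. measure N {\<omega> \<in> space N. Y \<omega> \<le> x} = spacing_cdf a k (c * x)"
  shows "eq_in_distr M X N Y"
proof -
  have "distr M lborel X = distr N lborel Y"
    using prob_space.distributed_spacing[OF assms(1) ak assms(6,8)]
      prob_space.distributed_spacing[OF assms(2) ak assms(7,9)]
    by (simp add: distributed_def)
  moreover have "distr M lborel X = distr M borel X" "distr N lborel Y = distr N borel Y"
    by (rule distr_cong; simp)+
  ultimately show ?thesis using assms(6,7) by (simp add: eq_in_distr_def)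
qed

section \<open>The beta and exponential representations\<close>

lemma beta_density_eq:
  assumes "a \<ge> 1" "k \<ge> 1"
  shows "beta_density (real k) (real a) p
    = (if 0 < p \<and> p < 1 then spacing_const a k * (1 - p) ^ (a - 1) * p ^ (k - 1) else 0)"
proof -
  have G: "Gamma (real j) = fact (j - 1)" if "j \<ge> 1" for j
    using Gamma_fact[of "j - 1", where 'a = real] that by (simp add: of_nat_diff)
  have "Beta (real k) (real a) = 1 / spacing_const a k"
    using G[of k] G[of a] G[of "a + k"] assms by (simp add: Beta_def spacing_const_def add.commute)
  moreover have "q powr (real j - 1) = q ^ (j - 1)" if "q > 0" "j \<ge> 1" for q :: real and j
    using powr_realpow[OF that(1), of "j - 1"] that(2) by (simp add: of_nat_diff)
  ultimately show ?thesis
    using assms by (simp add: beta_density_def)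
qed

text \<open>The event is \<rho> \<ge> exp(-cx), and the beta density is the derivative of the
  binomial tail in 1 - p. The upper tail of \<rho> is therefore a difference of binomial tails,
  which is the incomplete beta identity.\<close>

lemma prob_neg_ln_beta_le:
  assumes "prob_space N" and ak: "a \<ge> 1" "k \<ge> 1" and c: "c > 0"
    and \<rho>: "distributed N lborel \<rho> (\<lambda>x. ennreal (beta_density (real k) (real a) x))"
  shows "measure N {\<omega> \<in> space N. - (ln (\<rho> \<omega>) / c) \<le> x} = spacing_cdf a k (c * x)"
proof -
  interpret prob_space N by fact
  have \<rho>_meas [measurable]: "\<rho> \<in> borel_measurable N"
    using distributed_measurable[OF \<rho>] by simp
  define F where "F p = binom_lower (a + k - 1) a (1 - p)" for p
  define f where "f p = spacing_const a k * (1 - p) ^ (a - 1) * p ^ (k - 1)" for p :: real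
  have [measurable]: "f \<in> borel_measurable borel" unfolding f_def by measurable
  have F: "(F has_real_derivative f p) (at p)" for p
  proof -
    have "((\<lambda>p. 1 - p) has_real_derivative - 1) (at p)"
      by (auto intro!: derivative_eq_intros)
    from DERIV_chain2[OF binom_lower_deriv_spacing[OF ak] this]
    show ?thesis unfolding F_def[abs_def] f_def by simp
  qed
  define z where "z = exp (- (c * x))"
  have "z > 0" by (simp add: z_def)
  have "AE \<omega> in N. 0 < \<rho> \<omega> \<and> \<rho> \<omega> < 1"
    by (subst distributed_AE2[OF \<rho>]) (auto simp: beta_density_eq[OF ak])
  then have "AE \<omega> in N. - (ln (\<rho> \<omega>) / c) \<le> x \<longleftrightarrow> z \<le> \<rho> \<omega>"
  proof eventually_elim
    case (elim \<omega>)
    have "- (ln (\<rho> \<omega>) / c) \<le> x \<longleftrightarrow> - (c * x) \<le> ln (\<rho> \<omega>)"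
      using c by (simp add: field_simps) linarith
    also have "\<dots> \<longleftrightarrow> z \<le> \<rho> \<omega>"
      using elim unfolding z_def by (metis exp_le_cancel_iff exp_ln)
    finally show ?case .
  qed
  then have "prob {\<omega> \<in> space N. - (ln (\<rho> \<omega>) / c) \<le> x} = prob {\<omega> \<in> space N. z \<le> \<rho> \<omega>}"
    by (intro prob_eq_AE) auto
  also have "\<dots> = spacing_cdf a k (c * x)"
  proof -
    have "emeasure N {\<omega> \<in> space N. z \<le> \<rho> \<omega>} = emeasure N (\<rho> -` {z..} \<inter> space N)"
      by (intro arg_cong[where f = "emeasure N"]) auto
    also have "\<dots> = (\<integral>\<^sup>+p. ennreal (beta_density (real k) (real a) p) * indicator {z..} p \<partial>lborel)"
      by (rule distributed_emeasure[OF \<rho>]) simp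
    also have "\<dots> = (\<integral>\<^sup>+p. ennreal (f p) * indicator {z..1} p \<partial>lborel)"
      \<comment> \<open>For \<open>a = 1\<close> the formula \<open>f\<close> does not vanish at 1,
        where \<open>beta_density\<close> is 0.\<close>
      using AE_lborel_singleton[of "1::real"]
      by (intro nn_integral_cong_AE, eventually_elim)
         (use \<open>z > 0\<close> in \<open>auto simp: beta_density_eq[OF ak] f_def split: split_indicator\<close>)
    also have "\<dots> = ennreal (spacing_cdf a k (c * x))"
    proof (cases "z \<le> 1")
      case True
      have "(\<integral>\<^sup>+p. ennreal (f p) * indicator {z..1} p \<partial>lborel) = ennreal (F 1 - F z)"
        using \<open>z > 0\<close> True F spacing_const_pos[of a k]
        by (intro nn_integral_FTC_Icc) (auto simp: f_def intro!: mult_nonneg_nonneg)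
      also have "F 1 - F z = spacing_cdf a k (c * x)"
        using True ak by (simp add: F_def spacing_cdf_def z_def binom_lower_at_0 max_def)
      finally show ?thesis .
    next
      case False
      then show ?thesis using ak by (simp add: spacing_cdf_def max_def z_def[symmetric] binom_lower_at_0)
    qed
    finally show ?thesis
      using spacing_cdf_nonneg[OF ak] by (simp add: measure_def)
  qed
  finally show ?thesis .
qed

lemma prob_exponential_order_stat_le:
  assumes iid: "iid_sample N (a + k - 1) (exponential_cdf l) Y" and ak: "a \<ge> 1" "k \<ge> 1" and pos: "l > 0" "d > 0"
  shows "measure N {\<omega> \<in> space N. order_stat a (a + k - 1) Y \<omega> / d \<le> x} = spacing_cdf a k (l * d * x)"
proof -
  have "exponential_cdf l y = max 0 (1 - exp (- (l * y)))" for y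
    using pos(1) by (auto simp: exponential_cdf_def max_def zero_le_mult_iff mult_le_0_iff)
  moreover have "1 \<le> a" "a \<le> a + k - 1" using ak by auto
  ultimately show ?thesis
    using prob_order_stat_le[OF iid, of a "d * x"] pos(2)
    by (simp add: spacing_cdf_def pos_divide_le_eq mult_ac)
qed

text \<open>At most sk terms, each at most 1/k^2: crude, but it vanishes as k grows, as the limits
  in (iv) and (v) require.\<close>

lemma sum_inverse_squares_le:
  assumes k: "k \<ge> 1"
  shows "(\<Sum>r=k..<s*k. 1 / (real r)\<^sup>2) \<le> real s / real k"
proof -
  have "(\<Sum>r=k..<s*k. 1 / (real r)\<^sup>2) \<le> (\<Sum>r=k..<s*k. 1 / (real k)\<^sup>2)"
    using k by (intro sum_mono divide_left_mono power_mono) auto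
  also have "\<dots> = real (s * k - k) / (real k)\<^sup>2" by simp
  also have "\<dots> \<le> real (s * k) / (real k)\<^sup>2" by (intro divide_right_mono of_nat_mono) auto
  also have "\<dots> = real s / real k" using k by (simp add: power2_eq_square)
  finally show ?thesis .
qed

section \<open>The estimator for a fixed k\<close>

context
  fixes \<alpha> \<delta> :: real and s k :: nat and M :: "'a measure" and X :: "nat \<Rightarrow> 'a \<Rightarrow> real"
  assumes \<alpha>: "\<alpha> > 0" and \<delta>: "\<delta> > 0" and s: "s \<ge> 2" and k: "k \<ge> 1"
    and iid: "iid_sample M (k * (s + 1) - 1) (pareto_cdf \<alpha> \<delta>) X"
begin

interpretation prob_space M using iid by (simp add: iid_sample_def)

lemma Qstar_params:
  "\<alpha> * ln (real s) > 0" "(s - 1) * k \<ge> 1" "(s - 1) * k + k = s * k" "(s - 1) * k + k - 1 = k * s - 1"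
proof -
  show a: "(s - 1) * k + k = s * k" using s by (cases s) simp_all
  show "\<alpha> * ln (real s) > 0" using \<alpha> s by simp
  have "1 * 1 \<le> (s - 1) * k" using s k by (intro mult_le_mono) auto
  then show "(s - 1) * k \<ge> 1" by simp
  show "(s - 1) * k + k - 1 = k * s - 1" unfolding a by (simp add: mult.commute)
qed

lemmas Qstar_cdf = prob_Qstar_le(1)[OF \<alpha> \<delta> s k iid]
lemmas borel_measurable_Qstar = prob_Qstar_le(2)[OF \<alpha> \<delta> s k iid]

lemma eq_in_distr_Qstar_beta:
  assumes "prob_space N"
    and "distributed N lborel \<rho> (\<lambda>x. ennreal (beta_density (real k) (real ((s - 1) * k)) x))"
  shows "eq_in_distr M (Qstar k s X) N (\<lambda>\<omega>. - (ln (\<rho> \<omega>) / (\<alpha> * ln (real s))))"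
proof (rule eq_in_distr_spacing[OF prob_space_axioms assms(1) Qstar_params(2) k Qstar_params(1)
      borel_measurable_Qstar _ Qstar_cdf prob_neg_ln_beta_le[OF assms(1) Qstar_params(2) k Qstar_params(1) assms(2)]])
  have [measurable]: "\<rho> \<in> borel_measurable N"
    using distributed_measurable[OF assms(2)] by simp
  show "(\<lambda>\<omega>. - (ln (\<rho> \<omega>) / (\<alpha> * ln (real s)))) \<in> borel_measurable N" by measurable
qed

text \<open>Only the product of rate and divisor matters. Rate \<alpha> with divisor log(s) and rate
  1 with divisor \<alpha> log(s) give the two exponential representations in (i).\<close>

lemma eq_in_distr_Qstar_exponential:
  assumes Y: "iid_sample N (k * s - 1) (exponential_cdf l) Y" and pos: "l > 0" "d > 0" and ld: "l * d = \<alpha> * ln (real s)"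
  shows "eq_in_distr M (Qstar k s X) N (\<lambda>\<omega>. order_stat ((s - 1) * k) (k * s - 1) Y \<omega> / d)"
proof (rule eq_in_distr_spacing[OF prob_space_axioms _ Qstar_params(2) k Qstar_params(1)
      borel_measurable_Qstar _ Qstar_cdf])
  show "prob_space N" using Y by (simp add: iid_sample_def)
  have "(s - 1) * k \<le> k * s - 1" using Qstar_params(4) k by linarith
  then have [measurable]: "order_stat ((s - 1) * k) (k * s - 1) Y \<in> borel_measurable N"
    using Qstar_params(2) by (intro borel_measurable_order_stat[OF Y])
  show "(\<lambda>\<omega>. order_stat ((s - 1) * k) (k * s - 1) Y \<omega> / d) \<in> borel_measurable N" by measurable
  show "measure N {\<omega> \<in> space N. order_stat ((s - 1) * k) (k * s - 1) Y \<omega> / d \<le> x}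
      = spacing_cdf ((s - 1) * k) k (\<alpha> * ln (real s) * x)" for x
    using prob_exponential_order_stat_le[of N "(s - 1) * k" k l Y d x] Y pos Qstar_params(2) k ld
    unfolding Qstar_params(4) by simp
qed

lemma distributed_Qstar:
  "distributed M lborel (Qstar k s X) (\<lambda>x. ennreal (Qstar_density \<alpha> k s x))"
  unfolding Qstar_density_eq[OF s k \<alpha>]
  by (rule distributed_spacing[OF Qstar_params(2) k Qstar_params(1) borel_measurable_Qstar Qstar_cdf])

lemma distributed_scaled_Qstar:
  "distributed M lborel (\<lambda>\<omega>. \<alpha> * ln (real s) * Qstar k s X \<omega>) (\<lambda>x. ennreal (spacing_density ((s - 1) * k) k x))"
proof -
  have "prob {\<omega> \<in> space M. \<alpha> * ln (real s) * Qstar k s X \<omega> \<le> x} = spacing_cdf ((s - 1) * k) k (1 * x)" for x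
    using Qstar_cdf[of "x / (\<alpha> * ln (real s))"] Qstar_params(1) \<alpha> s
    by (simp add: pos_le_divide_eq mult.commute)
  with distributed_spacing[OF Qstar_params(2) k zero_less_one, of "\<lambda>\<omega>. \<alpha> * ln (real s) * Qstar k s X \<omega>"]
  show ?thesis using borel_measurable_Qstar by simp
qed

lemma Qstar_moments:
  shows "integrable M (Qstar k s X)" and "integrable M (\<lambda>\<omega>. (Qstar k s X \<omega>)\<^sup>2)"
    and "expectation (Qstar k s X) = (\<Sum>r=k..<s*k. 1 / real r) / (\<alpha> * ln (real s))"
    and "variance (Qstar k s X) = (\<Sum>r=k..<s*k. 1 / (real r)\<^sup>2) / (\<alpha>\<^sup>2 * (ln (real s))\<^sup>2)"
proof -
  let ?a = "(s - 1) * k" and ?c = "\<alpha> * ln (real s)"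
  define W where "W \<omega> = ?c * Qstar k s X \<omega>" for \<omega>
  note D = distributed_scaled_Qstar[folded W_def]
  have Q: "Qstar k s X = (\<lambda>\<omega>. W \<omega> / ?c)"
    using \<alpha> s by (simp add: W_def fun_eq_iff)
  have W1: "integrable M W" and W2: "integrable M (\<lambda>\<omega>. (W \<omega>)\<^sup>2)"
    using distributed_integrable[OF D, of "\<lambda>x. x"] distributed_integrable[OF D, of "\<lambda>x. x\<^sup>2"]
      integrable_spacing_moment[OF k, of ?a 1] integrable_spacing_moment[OF k, of ?a 2] spacing_density_nonneg
    by auto
  have E1: "expectation W = (\<Sum>r=k..<s*k. 1 / real r)"
    using distributed_integral[OF D, of "\<lambda>x. x"] spacing_mean[OF Qstar_params(2) k, unfolded Qstar_params(3)] spacing_density_nonneg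
    by simp
  have E2: "expectation (\<lambda>\<omega>. (W \<omega>)\<^sup>2) = (\<Sum>r=k..<s*k. 1 / (real r)\<^sup>2) + (\<Sum>r=k..<s*k. 1 / real r)\<^sup>2"
    using distributed_integral[OF D, of "\<lambda>x. x\<^sup>2"] spacing_second_moment[OF Qstar_params(2) k, unfolded Qstar_params(3)] spacing_density_nonneg
    by simp
  show int1: "integrable M (Qstar k s X)" unfolding Q using W1 by simp
  show int2: "integrable M (\<lambda>\<omega>. (Qstar k s X \<omega>)\<^sup>2)" unfolding Q power_divide using W2 by simp
  show E: "expectation (Qstar k s X) = (\<Sum>r=k..<s*k. 1 / real r) / ?c"
    unfolding Q by (simp add: E1)
  have "expectation (\<lambda>\<omega>. (Qstar k s X \<omega>)\<^sup>2) = expectation (\<lambda>\<omega>. (W \<omega>)\<^sup>2) / ?c\<^sup>2"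
    unfolding Q power_divide by simp
  then show "variance (Qstar k s X) = (\<Sum>r=k..<s*k. 1 / (real r)\<^sup>2) / (\<alpha>\<^sup>2 * (ln (real s))\<^sup>2)"
    using variance_eq[OF int1 int2] unfolding E E2
    by (simp add: power_divide power_mult_distrib add_divide_distrib)
qed

text \<open>Scaling by \<alpha> log(s) turns the centre 1/\<alpha> into log(s), the point about
  which \<open>spacing_tail_bound\<close> is stated, and removes \<alpha> from the density.\<close>

lemma Qstar_tail:
  assumes "\<epsilon> > 0"
  shows "prob {\<omega> \<in> space M. \<epsilon> < \<bar>Qstar k s X \<omega> - 1 / \<alpha>\<bar>}
    \<le> (\<Sum>r=k..<s*k. 1 / (real r)\<^sup>2) / (\<alpha>\<^sup>2 * \<epsilon>\<^sup>2 * (ln (real s))\<^sup>2)"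
proof -
  let ?a = "(s - 1) * k" and ?c = "\<alpha> * ln (real s)"
  define S where "S = {x. ?c * \<epsilon> < \<bar>x - ln (real s)\<bar>}"
  have S [measurable]: "S \<in> sets borel" unfolding S_def by measurable
  have [measurable]: "Qstar k s X \<in> borel_measurable M" by (rule borel_measurable_Qstar)
  have iff: "\<epsilon> < \<bar>Qstar k s X \<omega> - 1 / \<alpha>\<bar> \<longleftrightarrow> ?c * Qstar k s X \<omega> \<in> S" for \<omega>
  proof -
    have "?c * Qstar k s X \<omega> - ln (real s) = ?c * (Qstar k s X \<omega> - 1 / \<alpha>)"
      using \<alpha> by (simp add: field_simps)
    then have "\<bar>?c * Qstar k s X \<omega> - ln (real s)\<bar> = ?c * \<bar>Qstar k s X \<omega> - 1 / \<alpha>\<bar>"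
      using Qstar_params(1) by (simp only: abs_mult[of ?c "_ - _"] abs_of_pos)
    then show ?thesis
      using Qstar_params(1) unfolding S_def mem_Collect_eq by (simp only: mult_less_cancel_left_pos)
  qed
  have "prob {\<omega> \<in> space M. \<epsilon> < \<bar>Qstar k s X \<omega> - 1 / \<alpha>\<bar>}
      = expectation (indicator {\<omega> \<in> space M. \<epsilon> < \<bar>Qstar k s X \<omega> - 1 / \<alpha>\<bar>})"
    by (simp add: Int_absorb2 subset_eq)
  also have "\<dots> = expectation (\<lambda>\<omega>. indicator S (?c * Qstar k s X \<omega>))"
    using iff by (intro Bochner_Integration.integral_cong) (auto simp: indicator_def)
  also have "\<dots> = (\<integral>x. spacing_density ?a k x * indicator S x \<partial>lborel)"
    using distributed_integral[OF distributed_scaled_Qstar, of "indicator S"] spacing_density_nonneg by simp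
  finally have "(?c * \<epsilon>)\<^sup>2 * prob {\<omega> \<in> space M. \<epsilon> < \<bar>Qstar k s X \<omega> - 1 / \<alpha>\<bar>}
      \<le> (\<Sum>r=k..<s*k. 1 / (real r)\<^sup>2)"
    using spacing_tail_bound[OF Qstar_params(2) k Qstar_params(3), of "?c * \<epsilon>"] Qstar_params(1,3) assms
    by (simp add: S_def)
  moreover have "(?c * \<epsilon>)\<^sup>2 > 0" using \<alpha> s assms by simp
  moreover have "(?c * \<epsilon>)\<^sup>2 = \<alpha>\<^sup>2 * \<epsilon>\<^sup>2 * (ln (real s))\<^sup>2" by (simp add: power_mult_distrib)
  ultimately show ?thesis
    by (simp only: pos_le_divide_eq mult.commute[of _ "prob _"] if_False)
qed

text \<open>The mean of the scaled estimator is the sum of 1/r over k \<le> r < sk, which exceeds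
  log(s) by less than 1/k.\<close>

lemma Qstar_bias_le: "\<bar>expectation (Qstar k s X) - 1 / \<alpha>\<bar> \<le> (1 / (\<alpha> * ln (real s))) / real k"
proof -
  let ?c = "\<alpha> * ln (real s)"
  define \<mu> where "\<mu> = (\<Sum>r=k..<s*k. 1 / real r)"
  have km: "k \<le> s * k" using Qstar_params(3) by linarith
  have "ln (real (s * k)) - ln (real k) = ln (real s)" using s k by (simp add: ln_mult)
  then have b: "0 \<le> \<mu> - ln (real s)" "\<mu> - ln (real s) \<le> 2 / 3 * (1 / real k - 1 / real (s * k))"
    using harmonic_minus_ln_nonneg[OF k km] harmonic_minus_ln_le[OF k km] by (simp_all add: \<mu>_def)
  have "2 / 3 * (1 / real k - 1 / real (s * k)) \<le> 2 / 3 * (1 / real k)"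
    by (intro mult_left_mono) auto
  also have "\<dots> \<le> 1 / real k" using k by (simp add: field_simps)
  finally have "\<bar>\<mu> - ln (real s)\<bar> \<le> 1 / real k" using b by linarith
  moreover have "expectation (Qstar k s X) - 1 / \<alpha> = (\<mu> - ln (real s)) / ?c"
    using \<alpha> s by (simp add: Qstar_moments(3) \<mu>_def field_simps)
  then have "\<bar>expectation (Qstar k s X) - 1 / \<alpha>\<bar> = \<bar>\<mu> - ln (real s)\<bar> / ?c"
    using Qstar_params(1) by (simp only: abs_divide abs_of_pos)
  ultimately have "\<bar>expectation (Qstar k s X) - 1 / \<alpha>\<bar> \<le> 1 / real k / ?c"
    using divide_right_mono[OF _ less_imp_le[OF Qstar_params(1)]] by metis
  then show ?thesis by (simp add: mult_ac)
qed

end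

text \<open>Integrability is asserted beside the moments because the Bochner integral defaults to 0.
  Each k has its own space and sample, since the limits involve only the individual laws.\<close>

theorem corollary2:
  fixes \<alpha> \<delta> :: real and s :: nat
    and M :: "nat \<Rightarrow> 'a measure" and X :: "nat \<Rightarrow> nat \<Rightarrow> 'a \<Rightarrow> real"
  assumes "\<alpha> > 0" and "\<delta> > 0" and "s \<ge> 2"
  shows
    "(\<forall>k\<ge>1. iid_sample (M k) (k * (s + 1) - 1) (pareto_cdf \<alpha> \<delta>) (X k) \<longrightarrow>
        ((\<forall>(N :: 'b measure) \<rho>.
            prob_space N \<longrightarrow>
            distributed N lborel \<rho> (\<lambda>x. ennreal (beta_density (real k) (real ((s - 1) * k)) x)) \<longrightarrow>
            eq_in_distr (M k) (Qstar k s (X k)) N (\<lambda>\<omega>. - (ln (\<rho> \<omega>) / (\<alpha> * ln (real s))))) \<and>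
         (\<forall>(N :: 'c measure) Y.
            iid_sample N (k * s - 1) (exponential_cdf \<alpha>) Y \<longrightarrow>
            eq_in_distr (M k) (Qstar k s (X k))
              N (\<lambda>\<omega>. order_stat ((s - 1) * k) (k * s - 1) Y \<omega> / ln (real s))) \<and>
         (\<forall>(N :: 'd measure) Y.
            iid_sample N (k * s - 1) (exponential_cdf 1) Y \<longrightarrow>
            eq_in_distr (M k) (Qstar k s (X k))
              N (\<lambda>\<omega>. order_stat ((s - 1) * k) (k * s - 1) Y \<omega> / (\<alpha> * ln (real s)))) \<and>
         distributed (M k) lborel (Qstar k s (X k)) (\<lambda>x. ennreal (Qstar_density \<alpha> k s x)))
        \<and>
        (integrable (M k) (Qstar k s (X k)) \<and>
         integrable (M k) (\<lambda>\<omega>. (Qstar k s (X k) \<omega>)\<^sup>2) \<and>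
         prob_space.expectation (M k) (Qstar k s (X k))
           = (gen_harm (k * s - 1) 1 - gen_harm (k - 1) 1) / (\<alpha> * ln (real s)) \<and>
         prob_space.variance (M k) (Qstar k s (X k))
           = (gen_harm (k * s - 1) 2 - gen_harm (k - 1) 2) / (\<alpha>\<^sup>2 * (ln (real s))\<^sup>2))
        \<and>
        (\<forall>\<epsilon>>0.
           measure (M k) {\<omega> \<in> space (M k). \<bar>Qstar k s (X k) \<omega> - 1 / \<alpha>\<bar> > \<epsilon>}
             \<le> (gen_harm (k * s - 1) 2 - gen_harm (k - 1) 2) / (\<alpha>\<^sup>2 * \<epsilon>\<^sup>2 * (ln (real s))\<^sup>2)))
     \<and>
     ((\<forall>k\<ge>1. iid_sample (M k) (k * (s + 1) - 1) (pareto_cdf \<alpha> \<delta>) (X k)) \<longrightarrow>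
        ((\<lambda>k. prob_space.expectation (M k) (Qstar k s (X k))) \<longlonglongrightarrow> 1 / \<alpha> \<and>
         (\<lambda>k. prob_space.variance (M k) (Qstar k s (X k))) \<longlonglongrightarrow> 0)
        \<and>
        (\<forall>\<epsilon>>0. (\<lambda>k. measure (M k) {\<omega> \<in> space (M k). \<bar>Qstar k s (X k) \<omega> - 1 / \<alpha>\<bar> > \<epsilon>})
                  \<longlonglongrightarrow> 0))"
proof (intro conjI allI impI)
  have sums: "gen_harm (k * s - 1) j - gen_harm (k - 1) j = (\<Sum>r=k..<s * k. 1 / real r ^ j)" if "k \<ge> 1" for k j
    using gen_harm_diff[of k "k * s" j] that \<open>s \<ge> 2\<close> by (simp add: mult.commute)
  have sums1: "(\<Sum>r=k..<s * k. 1 / real r) = gen_harm (k * s - 1) 1 - gen_harm (k - 1) 1" if "k \<ge> 1" for k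
    using sums[OF that, of 1] by simp
  have lns: "ln (real s) > 0" using \<open>s \<ge> 2\<close> by simp
  note params = \<open>\<alpha> > 0\<close> \<open>\<delta> > 0\<close> \<open>s \<ge> 2\<close>
  {
    fix k assume k: "1 \<le> k" and iid: "iid_sample (M k) (k * (s + 1) - 1) (pareto_cdf \<alpha> \<delta>) (X k)"
    note p = params k iid
    show "eq_in_distr (M k) (Qstar k s (X k)) N (\<lambda>\<omega>. - (ln (\<rho> \<omega>) / (\<alpha> * ln (real s))))"
      if "prob_space N" "distributed N lborel \<rho> (\<lambda>x. ennreal (beta_density (real k) (real ((s - 1) * k)) x))"
      for N :: "'b measure" and \<rho>
      using that by (rule eq_in_distr_Qstar_beta[OF p])
    show "eq_in_distr (M k) (Qstar k s (X k)) N (\<lambda>\<omega>. order_stat ((s - 1) * k) (k * s - 1) Y \<omega> / ln (real s))"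
      if "iid_sample N (k * s - 1) (exponential_cdf \<alpha>) Y" for N :: "'c measure" and Y
      using that params lns by (intro eq_in_distr_Qstar_exponential[OF p]) auto
    show "eq_in_distr (M k) (Qstar k s (X k)) N (\<lambda>\<omega>. order_stat ((s - 1) * k) (k * s - 1) Y \<omega> / (\<alpha> * ln (real s)))"
      if "iid_sample N (k * s - 1) (exponential_cdf 1) Y" for N :: "'d measure" and Y
      using that params lns by (intro eq_in_distr_Qstar_exponential[OF p]) auto
    show "distributed (M k) lborel (Qstar k s (X k)) (\<lambda>x. ennreal (Qstar_density \<alpha> k s x))"
      by (rule distributed_Qstar[OF p])
    show "integrable (M k) (Qstar k s (X k))" "integrable (M k) (\<lambda>\<omega>. (Qstar k s (X k) \<omega>)\<^sup>2)"
      by (rule Qstar_moments(1,2)[OF p])+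
    show "prob_space.expectation (M k) (Qstar k s (X k))
        = (gen_harm (k * s - 1) 1 - gen_harm (k - 1) 1) / (\<alpha> * ln (real s))"
      unfolding sums1[OF k, symmetric] by (rule Qstar_moments(3)[OF p])
    show "prob_space.variance (M k) (Qstar k s (X k))
        = (gen_harm (k * s - 1) 2 - gen_harm (k - 1) 2) / (\<alpha>\<^sup>2 * (ln (real s))\<^sup>2)"
      unfolding sums[OF k] by (rule Qstar_moments(4)[OF p])
    show "measure (M k) {\<omega> \<in> space (M k). \<bar>Qstar k s (X k) \<omega> - 1 / \<alpha>\<bar> > \<epsilon>}
        \<le> (gen_harm (k * s - 1) 2 - gen_harm (k - 1) 2) / (\<alpha>\<^sup>2 * \<epsilon>\<^sup>2 * (ln (real s))\<^sup>2)" if "\<epsilon> > 0" for \<epsilon>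
      unfolding sums[OF k] using that by (rule Qstar_tail[OF p])
  }
  assume iid: "\<forall>k\<ge>1. iid_sample (M k) (k * (s + 1) - 1) (pareto_cdf \<alpha> \<delta>) (X k)"
  then have p: "iid_sample (M k) (k * (s + 1) - 1) (pareto_cdf \<alpha> \<delta>) (X k)" if "k \<ge> 1" for k
    using that by blast
  have bias: "\<forall>\<^sub>F k in sequentially. \<bar>prob_space.expectation (M k) (Qstar k s (X k)) - 1 / \<alpha>\<bar> \<le> 1 / (\<alpha> * ln (real s)) / real k"
    using eventually_ge_at_top[of 1] by eventually_elim (rule Qstar_bias_le[OF params _ p])
  have "(\<lambda>k. \<bar>prob_space.expectation (M k) (Qstar k s (X k)) - 1 / \<alpha>\<bar>) \<longlonglongrightarrow> 0"
    by (rule tendsto_sandwich[OF _ bias tendsto_const lim_const_over_n]) simp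
  then show "(\<lambda>k. prob_space.expectation (M k) (Qstar k s (X k))) \<longlonglongrightarrow> 1 / \<alpha>"
    by (rule LIM_zero_cancel[OF tendsto_rabs_zero_cancel])
  \<comment> \<open>One squeeze serves both limits: \<open>c\<close> is \<alpha>^2 log(s)^2 for the
    variance, with a further factor \<epsilon>^2 for the tail. The bounds hold only from k = 1
    on.\<close>
  have bound: "(\<lambda>k. f k) \<longlonglongrightarrow> 0"
    if f: "\<And>k. k \<ge> 1 \<Longrightarrow> 0 \<le> f k" "\<And>k. k \<ge> 1 \<Longrightarrow> f k \<le> (\<Sum>r=k..<s * k. 1 / (real r)\<^sup>2) / c" and c: "c > 0"
    for f :: "nat \<Rightarrow> real" and c
  proof (rule tendsto_sandwich[OF _ _ tendsto_const lim_const_over_n])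
    show "\<forall>\<^sub>F k in sequentially. 0 \<le> f k"
      using eventually_ge_at_top[of 1] by eventually_elim (rule f(1))
    show "\<forall>\<^sub>F k in sequentially. f k \<le> real s / c / real k"
      using eventually_ge_at_top[of 1]
    proof eventually_elim
      case (elim k)
      have "(\<Sum>r=k..<s * k. 1 / (real r)\<^sup>2) / c \<le> real s / real k / c"
        using sum_inverse_squares_le[OF elim] c by (intro divide_right_mono) auto
      with f(2)[OF elim] show ?case by (simp add: mult.commute)
    qed
  qed
  show "(\<lambda>k. prob_space.variance (M k) (Qstar k s (X k))) \<longlonglongrightarrow> 0"
  proof (rule bound)
    show "prob_space.variance (M k) (Qstar k s (X k)) \<le> (\<Sum>r=k..<s * k. 1 / (real r)\<^sup>2) / (\<alpha>\<^sup>2 * (ln (real s))\<^sup>2)"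
      if "k \<ge> 1" for k
      using Qstar_moments(4)[OF params that p[OF that]] by simp
  qed (use params lns in auto)
  show "(\<lambda>k. measure (M k) {\<omega> \<in> space (M k). \<bar>Qstar k s (X k) \<omega> - 1 / \<alpha>\<bar> > \<epsilon>}) \<longlonglongrightarrow> 0"
    if "\<epsilon> > 0" for \<epsilon>
  proof (rule bound)
    show "measure (M k) {\<omega> \<in> space (M k). \<bar>Qstar k s (X k) \<omega> - 1 / \<alpha>\<bar> > \<epsilon>}
        \<le> (\<Sum>r=k..<s * k. 1 / (real r)\<^sup>2) / (\<alpha>\<^sup>2 * \<epsilon>\<^sup>2 * (ln (real s))\<^sup>2)" if "k \<ge> 1" for k
      using Qstar_tail[OF params that p[OF that] \<open>\<epsilon> > 0\<close>] .
  qed (use params lns that in auto)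
qed

end
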